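(* Let $Y$ be the matrix of (right) eigenvectors of $A-GX$ obtained from the stable invariant subspace of the Hamiltonian matrix, with eigenvalues $0>\lambda_1^->\dots>\lambda_n^-$ as in the context, let $\eta$ be the condition number of $Y^{-1}$, and assume that each column of $B_d\in\mathbb R^{n\times n_b}$ has unit norm. Let $1\le\kappa<n$, and fix $0<r\le n$. Let $\xi^*$ be the minimum of $\xi=\|\Phi^{\frac12}-P^TP\Phi^{\frac12}\|_F$ and $\xi_\kappa^*$ the minimum of $\xi_\kappa=\|\Phi_\kappa^{\frac12}-P^TP\Phi_\kappa^{\frac12}\|_F$, both over clustering-based projection matrices $P\in\mathbb R^{r\times n}$. Then $$\xi^*-\xi_\kappa^*\le\sqrt{\eta^2\,n_b\sum_{i=\kappa+1}^n-\frac1{2\lambda_i^-}} .$$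
   Context: System: $\dot x=Ax+Bu+B_dd$ with $x\in\mathbb R^n$, $u\in\mathbb R^m$, $d\in\mathbb R^{n_b}$; $Q=Q^T\succeq0$, $R=R^T\succ0$, $G=BR^{-1}B^T$. Standing assumptions: $(Q^{\frac T2},A)$ observable, $(A,BR^{-\frac12})$ stabilizable, $(A,B_d)$ controllable. $X\succ0$ is the unique stabilizing solution of $A^TX+XA+Q-XGX=0$. Hamiltonian: $H=\begin{bmatrix}A&-G\\-Q&-A^T\end{bmatrix}$ is assumed diagonalizable, and the columns of $\begin{bmatrix}Y\\Z\end{bmatrix}\in\mathbb R^{2n\times n}$ span its stable invariant subspace: $H\begin{bmatrix}Y\\Z\end{bmatrix}=\begin{bmatrix}Y\\Z\end{bmatrix}\Lambda^-$ with $\Lambda^-=\mathrm{diag}(\lambda_1^-,\dots,\lambda_n^-)$ containing all eigenvalues of $H$ in the open left half plane, $0>\lambda_1^->\dots>\lambda_n^-$. Then $X=ZY^{-1}$ and $A-GX=Y\Lambda^-Y^{-1}$. $\Phi=\Phi^{\frac12}\Phi^{\frac T2}\succ0$ (with $\Phi^{\frac T2}=(\Phi^{\frac12})^T$) is the solution of $(A-GX)\Phi+\Phi(A-GX)^T+B_dB_d^T=0$; equivalently $\Phi=Y(Y^{-1}B_dB_d^TY^{-T}\circ\mathcal C)Y^T$, where $\circ$ is the Hadamard product and $\mathcal C\in\mathbb R^{n\times n}$ is the Cauchy matrix $\mathcal C_{i,j}=-\frac1{\lambda_i^-+\lambda_j^-}$. Its truncation is $\Phi_\kappa=\Phi_\kappa^{\frac12}\Phi_\kappa^{\frac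 T2}=Y_1(\Omega_1B_dB_d^T\Omega_1^T\circ\mathcal C_{1,1})Y_1^T$, where $Y_1$ consists of the first $\kappa$ columns of $Y$, $\Omega_1$ of the first $\kappa$ rows of $Y^{-1}$, and $\mathcal C_{1,1}$ is the leading $\kappa\times\kappa$ block of $\mathcal C$; $\Phi_\kappa^{\frac12}=Y_1(\Omega_1B_dB_d^T\Omega_1^T\circ\mathcal C_{1,1})^{\frac12}\in\mathbb R^{n\times\kappa}$. Clustering-based projection: for a partition $\mathcal I=\{\mathcal I_1,\dots,\mathcal I_r\}$ of $\{1,\dots,n\}$ into nonempty disjoint sets and $w\in\mathbb R^n$ with each subvector $w_{\mathcal I_i}$ nonzero, $P\in\mathbb R^{r\times n}$ is given by $P_{i,j}=w_j/\|w_{\mathcal I_i}\|_2$ if $j\in\mathcal I_i$ and $P_{i,j}=0$ otherwise. $\|\cdot\|_F$ is the Frobenius norm; the condition number is $\bar\sigma(Y)\bar\sigma(Y^{-1})$, $\bar\sigma$ being the largest singular value. *)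

theory Defs
  imports
    "Jordan_Normal_Form.Spectral_Radius"
    "Jordan_Normal_Form.Matrix_Kernel"
    "HOL-Analysis.Function_Topology"
begin

text \<open>
  Matrices and vectors are indexed from \<open>0\<close>, so the paper's \<open>i\<close>-th row, column, cluster or
  eigenvalue is number \<open>i - 1\<close> here.
\<close>

section \<open>Matrices\<close>

text \<open>Only meaningful for invertible matrices; \<open>mat_inverse\<close> returns an option.\<close>
abbreviation minv :: "real mat \<Rightarrow> real mat" where
  "minv A \<equiv> the (mat_inverse A)"

abbreviation cmat :: "real mat \<Rightarrow> complex mat" where
  "cmat A \<equiv> map_mat complex_of_real A"

definition symmetric :: "real mat \<Rightarrow> bool" where
  "symmetric M \<longleftrightarrow> transpose_mat M = M"

definition pos_semidef :: "real mat \<Rightarrow> bool" where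
  "pos_semidef M \<longleftrightarrow> symmetric M \<and>
     (\<forall>v \<in> carrier_vec (dim_row M). 0 \<le> scalar_prod v (M *\<^sub>v v))"

definition pos_def :: "real mat \<Rightarrow> bool" where
  "pos_def M \<longleftrightarrow> symmetric M \<and>
     (\<forall>v \<in> carrier_vec (dim_row M). v \<noteq> 0\<^sub>v (dim_row M) \<longrightarrow> 0 < scalar_prod v (M *\<^sub>v v))"

definition hadamard :: "real mat \<Rightarrow> real mat \<Rightarrow> real mat" where
  "hadamard M N = mat (dim_row M) (dim_col M) (\<lambda>(i, j). M $$ (i, j) * N $$ (i, j))"

definition frob_norm :: "real mat \<Rightarrow> real" where
  "frob_norm M = sqrt (\<Sum>i<dim_row M. \<Sum>j<dim_col M. (M $$ (i, j))\<^sup>2)"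

definition sigma_max :: "real mat \<Rightarrow> real" where
  "sigma_max M = Max (sqrt ` spectrum (transpose_mat M * M))"

definition cond_number :: "real mat \<Rightarrow> real" where
  "cond_number M = sigma_max M * sigma_max (minv M)"

definition first_cols :: "nat \<Rightarrow> real mat \<Rightarrow> real mat" where
  "first_cols k M = mat (dim_row M) k (\<lambda>(i, j). M $$ (i, j))"

definition first_rows :: "nat \<Rightarrow> real mat \<Rightarrow> real mat" where
  "first_rows k M = mat k (dim_col M) (\<lambda>(i, j). M $$ (i, j))"

text \<open>The \<open>k \<times> k\<close> matrix below is the leading block of each larger one.\<close>
definition cauchy_mat :: "nat \<Rightarrow> (nat \<Rightarrow> real) \<Rightarrow> real mat" where
  "cauchy_mat k lam = mat k k (\<lambda>(i, j). - 1 / (lam i + lam j))"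

text \<open>Diagonalizability over the complex numbers.\<close>
definition diagonalizable :: "real mat \<Rightarrow> bool" where
  "diagonalizable M \<longleftrightarrow> (\<exists>D. diagonal_mat D \<and> similar_mat (cmat M) D)"

section \<open>Linear systems\<close>

definition hurwitz :: "real mat \<Rightarrow> bool" where
  "hurwitz A \<longleftrightarrow> (\<forall>z \<in> spectrum (cmat A). Re z < 0)"

text \<open>\<open>x\<close> solves \<open>x' = A x + g\<close> on \<open>[0, T]\<close>, with one-sided derivatives at the end points.\<close>
definition trajectory ::
    "real mat \<Rightarrow> (real \<Rightarrow> real vec) \<Rightarrow> real \<Rightarrow> (real \<Rightarrow> real vec) \<Rightarrow> bool" where
  "trajectory A g T x \<longleftrightarrow>
     (\<forall>t \<in> {0..T}. x t \<in> carrier_vec (dim_row A) \<and>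
       (\<forall>i < dim_row A.
          ((\<lambda>s. x s $ i) has_real_derivative (A *\<^sub>v x t + g t) $ i) (at t within {0..T})))"

definition controllable :: "real mat \<Rightarrow> real mat \<Rightarrow> bool" where
  "controllable A B \<longleftrightarrow>
     (\<forall>T > 0. \<forall>x0 \<in> carrier_vec (dim_row A). \<forall>x1 \<in> carrier_vec (dim_row A).
       \<exists>u x. (\<forall>t \<in> {0..T}. u t \<in> carrier_vec (dim_col B)) \<and>
             (\<forall>j < dim_col B. continuous_on {0..T} (\<lambda>t. u t $ j)) \<and>
             trajectory A (\<lambda>t. B *\<^sub>v u t) T x \<and> x 0 = x0 \<and> x T = x1)"

definition observable :: "real mat \<Rightarrow> real mat \<Rightarrow> bool" where
  "observable C A \<longleftrightarrow>
     (\<forall>T > 0. \<forall>x y.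
       trajectory A (\<lambda>t. 0\<^sub>v (dim_row A)) T x \<longrightarrow> trajectory A (\<lambda>t. 0\<^sub>v (dim_row A)) T y \<longrightarrow>
       (\<forall>t \<in> {0..T}. C *\<^sub>v x t = C *\<^sub>v y t) \<longrightarrow> x 0 = y 0)"

definition stabilizable :: "real mat \<Rightarrow> real mat \<Rightarrow> bool" where
  "stabilizable A B \<longleftrightarrow> (\<exists>K \<in> carrier_mat (dim_col B) (dim_row A). hurwitz (A + B * K))"

definition stabilizing_riccati_solution ::
    "real mat \<Rightarrow> real mat \<Rightarrow> real mat \<Rightarrow> real mat \<Rightarrow> bool" where
  "stabilizing_riccati_solution A Q G X \<longleftrightarrow>
     X \<in> carrier_mat (dim_row A) (dim_row A) \<and>
     transpose_mat A * X + X * A + Q - X * G * X = 0\<^sub>m (dim_row A) (dim_row A) \<and>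
     hurwitz (A - G * X)"

definition hamiltonian :: "real mat \<Rightarrow> real mat \<Rightarrow> real mat \<Rightarrow> real mat" where
  "hamiltonian A G Q = four_block_mat A (- G) (- Q) (- transpose_mat A)"

text \<open>
  The real vectors in the complex span of the generalized eigenvectors for the eigenvalues in the
  open left half plane.
\<close>
definition stable_subspace :: "real mat \<Rightarrow> real vec set" where
  "stable_subspace H =
     {v \<in> carrier_vec (dim_row H).
        map_vec complex_of_real v \<in>
          LinearCombinations.module.span class_ring (module_vec TYPE(complex) (dim_row H))
            (\<Union>z \<in> {z \<in> spectrum (cmat H). Re z < 0}.
               \<Union>k. mat_kernel (char_matrix (cmat H) z ^\<^sub>m k))}"

definition column_span :: "real mat \<Rightarrow> real vec set" where
  "column_span M =
     LinearCombinations.module.span class_ring (module_vec TYPE(real) (dim_row M)) (set (cols M))"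

section \<open>Clustering-based projections\<close>

definition is_clustering :: "nat \<Rightarrow> nat \<Rightarrow> (nat \<Rightarrow> nat set) \<Rightarrow> bool" where
  "is_clustering n r I \<longleftrightarrow>
     (\<forall>i<r. I i \<noteq> {}) \<and> disjoint_family_on I {..<r} \<and> (\<Union>i<r. I i) = {..<n}"

definition clustering_proj :: "nat \<Rightarrow> nat \<Rightarrow> (nat \<Rightarrow> nat set) \<Rightarrow> real vec \<Rightarrow> real mat" where
  "clustering_proj n r I w =
     mat r n (\<lambda>(i, j). if j \<in> I i then w $ j / sqrt (\<Sum>l \<in> I i. (w $ l)\<^sup>2) else 0)"

definition clustering_projs :: "nat \<Rightarrow> nat \<Rightarrow> real mat set" where
  "clustering_projs n r =
     {clustering_proj n r I w | I w.
        is_clustering n r I \<and> w \<in> carrier_vec n \<and> (\<forall>i<r. \<exists>j \<in> I i. w $ j \<noteq> 0)}"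

definition proj_error :: "real mat \<Rightarrow> real mat \<Rightarrow> real" where
  "proj_error M P = frob_norm (M - transpose_mat P * P * M)"

text \<open>The minimum is attained, see \<open>min_proj_error_is_minimum\<close>.\<close>
definition min_proj_error :: "nat \<Rightarrow> nat \<Rightarrow> real mat \<Rightarrow> real" where
  "min_proj_error n r M = (LEAST x. x \<in> proj_error M ` clustering_projs n r)"

lemma exists_min_proj_error:
  assumes r: "0 < r" "r \<le> n" and M: "M \<in> carrier_mat n k"
  shows "\<exists>x \<in> proj_error M ` clustering_projs n r. \<forall>y \<in> proj_error M ` clustering_projs n r. x \<le> y"
proof -
  define Pm :: "(nat \<Rightarrow> nat set) \<Rightarrow> (nat \<Rightarrow> real) \<Rightarrow> real mat"
    where "Pm I w = mat r n (\<lambda>(i, j). if j \<in> I i then w j else 0)" for I w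
  define K :: "(nat \<Rightarrow> nat set) \<Rightarrow> (nat \<Rightarrow> real) set"
    where "K I = Pi UNIV (\<lambda>_. {-1..1}) \<inter> {w. \<forall>i<r. (\<Sum>l\<in>I i. (w l)\<^sup>2) = 1}" for I
  define F where "F = {I \<in> PiE {..<r} (\<lambda>_. Pow {..<n}). is_clustering n r I}"
  have finF: "finite F" unfolding F_def
    by (rule finite_subset[of _ "PiE {..<r} (\<lambda>_. Pow {..<n})"]) (auto intro!: finite_PiE)
  have sub: "I i \<subseteq> {..<n}" if "is_clustering n r I" "i < r" for I i
    using that unfolding is_clustering_def by auto
  have fin: "finite (I i)" if "is_clustering n r I" "i < r" for I i
    using sub[OF that] finite_subset by blast
  \<comment> \<open>the admissible projections, parametrised by normalised weights\<close>
  have inP: "Pm I w \<in> clustering_projs n r" if I: "is_clustering n r I" and w: "w \<in> K I" for I w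
  proof -
    have s: "(\<Sum>l\<in>I i. (vec n w $ l)\<^sup>2) = 1" if "i < r" for i
    proof -
      have "(\<Sum>l\<in>I i. (vec n w $ l)\<^sup>2) = (\<Sum>l\<in>I i. (w l)\<^sup>2)"
        using sub[OF I that] by (intro sum.cong) auto
      then show ?thesis using w that unfolding K_def by auto
    qed
    have "Pm I w = clustering_proj n r I (vec n w)"
      unfolding Pm_def clustering_proj_def by (rule eq_matI) (auto simp: s)
    moreover have "\<exists>j\<in>I i. vec n w $ j \<noteq> 0" if "i < r" for i
    proof (rule ccontr)
      assume "\<not> ?thesis"
      then have "(\<Sum>l\<in>I i. (vec n w $ l)\<^sup>2) = 0" by (intro sum.neutral) auto
      with s[OF that] show False by simp
    qed
    ultimately show ?thesis using I unfolding clustering_projs_def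
      by (auto intro!: exI[of _ I] exI[of _ "vec n w"])
  qed
  have fromP: "\<exists>I\<in>F. \<exists>w\<in>K I. P = Pm I w" if "P \<in> clustering_projs n r" for P
  proof -
    from that obtain I w where P: "P = clustering_proj n r I w" and I: "is_clustering n r I"
      and w: "\<And>i. i < r \<Longrightarrow> \<exists>j\<in>I i. w $ j \<noteq> 0" unfolding clustering_projs_def by auto
    define J where "J = restrict I {..<r}"
    have J: "is_clustering n r J" using I unfolding is_clustering_def J_def disjoint_family_on_def
      by auto
    have JF: "J \<in> F" unfolding F_def using J sub[OF I] by (auto simp: J_def PiE_def)
    define s where "s i = (\<Sum>l\<in>I i. (w $ l)\<^sup>2)" for i
    have spos: "s i > 0" if "i < r" for i
    proof -
      from w[OF that] obtain j where j: "j \<in> I i" "w $ j \<noteq> 0" by auto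
      show ?thesis unfolding s_def
        by (rule sum_pos2[OF fin[OF I that] j(1)]) (use j in auto)
    qed
    define idx where "idx j = (SOME i. i < r \<and> j \<in> I i)" for j
    have idx: "idx j = i" if "i < r" "j \<in> I i" for i j
    proof -
      have "idx j < r \<and> j \<in> I (idx j)" unfolding idx_def by (rule someI[of _ i]) (use that in auto)
      with that I show ?thesis unfolding is_clustering_def disjoint_family_on_def by blast
    qed
    define v where "v j = (if j < n then w $ j / sqrt (s (idx j)) else 0)" for j
    have v: "v j = w $ j / sqrt (s i)" if "i < r" "j \<in> I i" for i j
      using idx[OF that] sub[OF I that(1)] that unfolding v_def by auto
    have sum1: "(\<Sum>l\<in>I i. (v l)\<^sup>2) = 1" if "i < r" for i
    proof -
      have "(\<Sum>l\<in>I i. (v l)\<^sup>2) = (\<Sum>l\<in>I i. (w $ l)\<^sup>2 / s i)"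
        using that spos[OF that] by (intro sum.cong) (auto simp: v power_divide)
      also have "\<dots> = s i / s i" unfolding s_def by (rule sum_divide_distrib[symmetric])
      finally show ?thesis using spos[OF that] by simp
    qed
    have "v j \<in> {-1..1}" for j
    proof (cases "j < n")
      case True
      then obtain i where i: "i < r" "j \<in> I i" using I unfolding is_clustering_def by blast
      have "(v j)\<^sup>2 \<le> (\<Sum>l\<in>I i. (v l)\<^sup>2)"
        by (rule member_le_sum[OF i(2)]) (use fin[OF I i(1)] in auto)
      with sum1[OF i(1)] have "\<bar>v j\<bar> \<le> 1" by (simp add: abs_square_le_1)
      then show ?thesis by auto
    qed (simp add: v_def)
    then have "v \<in> K J" using sum1 unfolding K_def J_def by auto
    moreover have "P = Pm J v" unfolding P clustering_proj_def Pm_def J_def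
      by (rule eq_matI) (auto simp: v s_def)
    ultimately show ?thesis using JF by blast
  qed
  have cont: "continuous_on UNIV (\<lambda>w. w j)" for j :: nat
    by (rule continuous_on_product_coordinates)
  have comp: "compact (K I)" for I
  proof -
    have "compactin (product_topology (\<lambda>_. euclidean) UNIV) (PiE UNIV (\<lambda>_::nat. {-1..1::real}))"
      by (subst compactin_PiE) auto
    then have c: "compact (Pi UNIV (\<lambda>_::nat. {-1..1::real}))"
      by (simp add: euclidean_product_topology PiE_UNIV_domain)
    have "closed {w. \<forall>i<r. (\<Sum>l\<in>I i. (w l)\<^sup>2) = (1::real)}"
      by (intro closed_Collect_all closed_Collect_imp open_Collect_const closed_Collect_eq
          continuous_intros cont)
    then show ?thesis unfolding K_def using c by (rule compact_Int_closed[rotated])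
  qed
  have contE: "continuous_on S (\<lambda>w. proj_error M (Pm I w))" for S I
  proof -
    have e: "proj_error M (Pm I w) = sqrt (\<Sum>i<n. \<Sum>j<k. (M $$ (i, j) -
        (\<Sum>l<n. (\<Sum>a<r. (if i \<in> I a then w i else 0) * (if l \<in> I a then w l else 0)) * M $$ (l, j)))\<^sup>2)"
      for w
      using M unfolding proj_error_def frob_norm_def Pm_def
      by (auto simp: scalar_prod_def lessThan_atLeast0 intro!: sum.cong)
    have c: "continuous_on S (\<lambda>w. if b then w i else 0)" for b and i :: nat
      and S :: "(nat \<Rightarrow> real) set"
      by (cases b) (auto intro: continuous_on_subset[OF cont])
    show ?thesis unfolding e by (intro continuous_intros c)
  qed
  have "\<exists>w\<in>K I. \<forall>v\<in>K I. proj_error M (Pm I w) \<le> proj_error M (Pm I v)" if I: "I \<in> F" for I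
  proof -
    define h where "h i = (SOME j. j \<in> I i)" for i
    have Ic: "is_clustering n r I" using I unfolding F_def by auto
    have h: "h i \<in> I i" if "i < r" for i
      using Ic that unfolding is_clustering_def h_def by (meson ex_in_conv someI_ex)
    have "(\<Sum>l\<in>I i. (if l = h i then 1 else 0)) = (1::real)" if "i < r" for i
      using h[OF that] fin[OF Ic that] by simp
    moreover have "(if l \<in> h ` {..<r} then 1 else 0) = (if l = h i then 1 else (0::real))"
      if "i < r" "l \<in> I i" for i l
    proof -
      have "i = a" if "a < r" "l = h a" for a
        using h[OF that(1)] that \<open>i < r\<close> \<open>l \<in> I i\<close> Ic
        unfolding is_clustering_def disjoint_family_on_def by blast
      then have "l \<in> h ` {..<r} \<longleftrightarrow> l = h i" using \<open>i < r\<close> by blast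
      then show ?thesis by simp
    qed
    ultimately have sumh: "(\<Sum>l\<in>I i. (if l \<in> h ` {..<r} then 1 else (0::real))) = 1" if "i < r" for i
      using that by (simp cong: sum.cong)
    have "(\<lambda>l. if l \<in> h ` {..<r} then 1 else 0) \<in> K I"
    proof -
      have "(if b then 1 else (0::real))\<^sup>2 = (if b then 1 else 0)" for b by simp
      then show ?thesis unfolding K_def using sumh by (simp only: Int_iff mem_Collect_eq) auto
    qed
    then have "K I \<noteq> {}" by blast
    from continuous_attains_inf[OF comp this contE] show ?thesis .
  qed
  then obtain W where W: "\<And>I. I \<in> F \<Longrightarrow> W I \<in> K I"
    "\<And>I v. I \<in> F \<Longrightarrow> v \<in> K I \<Longrightarrow> proj_error M (Pm I (W I)) \<le> proj_error M (Pm I v)"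
    by metis
  have "F \<noteq> {}"
  proof -
    define J where "J = restrict (\<lambda>i. {j. j < n \<and> min j (r - 1) = i}) {..<r}"
    have "i \<in> J i" if "i < r" for i using that r unfolding J_def by auto
    then have "is_clustering n r J" using r
      unfolding is_clustering_def disjoint_family_on_def by (fastforce simp: J_def)
    then have "J \<in> F" unfolding F_def by (auto simp: J_def)
    then show ?thesis by blast
  qed
  then obtain I0 where I0: "I0 \<in> F"
    "\<And>I. I \<in> F \<Longrightarrow> proj_error M (Pm I0 (W I0)) \<le> proj_error M (Pm I (W I))"
    using ex_min_if_finite[of "(\<lambda>I. proj_error M (Pm I (W I))) ` F"] finF
    by (force simp: not_less)
  show ?thesis
  proof (rule bexI[of _ "proj_error M (Pm I0 (W I0))"], rule ballI)
    fix y assume "y \<in> proj_error M ` clustering_projs n r"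
    then obtain I v where "I \<in> F" "v \<in> K I" "y = proj_error M (Pm I v)" using fromP by blast
    with I0(2) W(2) show "proj_error M (Pm I0 (W I0)) \<le> y" by (meson order_trans)
  next
    show "proj_error M (Pm I0 (W I0)) \<in> proj_error M ` clustering_projs n r"
      using inP[OF _ W(1)[OF I0(1)]] I0(1) unfolding F_def by auto
  qed
qed

lemma min_proj_error_is_minimum:
  assumes "0 < r" "r \<le> n" "M \<in> carrier_mat n k"
  shows "min_proj_error n r M \<in> proj_error M ` clustering_projs n r"
    and "P \<in> clustering_projs n r \<Longrightarrow> min_proj_error n r M \<le> proj_error M P"
proof -
  obtain x where x: "x \<in> proj_error M ` clustering_projs n r"
    "\<And>y. y \<in> proj_error M ` clustering_projs n r \<Longrightarrow> x \<le> y"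
    using exists_min_proj_error[OF assms] by blast
  have "min_proj_error n r M = x" unfolding min_proj_error_def
    by (rule Least_equality) (use x in auto)
  with x show "min_proj_error n r M \<in> proj_error M ` clustering_projs n r"
    and "P \<in> clustering_projs n r \<Longrightarrow> min_proj_error n r M \<le> proj_error M P" by auto
qed

end

theory Submission
  imports Defs "HOL-Analysis.L2_Norm"
begin

text \<open>
  Diagonalising the Hamiltonian shows that the columns of \<open>[I; X]\<close> lie in its stable subspace, so
  that \<open>[I; X] = [Y; Z] T\<close>; hence \<open>T\<close> is inverse to \<open>Y\<close> and \<open>(A - G X) Y = Y \<Lambda>\<close>.
  In these coordinates \<open>N = T \<Phi>half\<close> satisfies \<open>N N\<^sup>T = T Bd Bd\<^sup>T T\<^sup>T \<circ> C\<close>. Split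
  \<open>\<Phi>half = Y\<^sub>1 N\<^sub>1 + Y\<^sub>2 N\<^sub>2\<close>. A Frobenius norm \<open>\<parallel>K N\<^sub>1\<parallel>\<close> depends on \<open>N\<^sub>1\<close> only
  through \<open>N\<^sub>1 N\<^sub>1\<^sup>T\<close>, so the first summand has the same projection error as \<open>\<Phi>khalf\<close>, and the
  choice of square roots is immaterial. The second contributes at most
  \<open>\<sigma>(Y) \<parallel>N\<^sub>2\<parallel>\<close>, where \<open>\<parallel>N\<^sub>2\<parallel>\<^sup>2\<close> is the trace of the trailing block of \<open>N N\<^sup>T\<close>, and
  \<open>\<parallel>T Bd\<parallel>\<^sup>2 \<le> \<sigma>(T)\<^sup>2 nb\<close> bounds its diagonal entries.
\<close>

section \<open>Frobenius norm and largest singular value\<close>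

lemma frob_norm_nonneg: "0 \<le> frob_norm M"
  unfolding frob_norm_def by (intro real_sqrt_ge_zero sum_nonneg) auto

lemma frob_norm_power2:
  "(frob_norm M)\<^sup>2 = (\<Sum>i<dim_row M. \<Sum>j<dim_col M. (M $$ (i, j))\<^sup>2)"
  unfolding frob_norm_def by (rule real_sqrt_pow2) (intro sum_nonneg zero_le_power2)

lemma frob_norm_power2_cols:
  "(frob_norm M)\<^sup>2 = (\<Sum>j<dim_col M. col M j \<bullet> col M j)"
  unfolding frob_norm_power2
  by (subst sum.swap) (auto simp: scalar_prod_def power2_eq_square lessThan_atLeast0 intro!: sum.cong)

lemma frob_norm_power2_gram:
  "(frob_norm M)\<^sup>2 = (\<Sum>i<dim_row M. (M * transpose_mat M) $$ (i, i))"
  unfolding frob_norm_power2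
  by (auto simp: scalar_prod_def power2_eq_square lessThan_atLeast0 intro!: sum.cong)

text \<open>Flattening a matrix to one vector indexed by pairs makes the triangle inequality for
  \<open>L2_set\<close> available.\<close>

lemma frob_norm_L2_set:
  "frob_norm M = L2_set (\<lambda>p. M $$ p) ({..<dim_row M} \<times> {..<dim_col M})"
  unfolding frob_norm_def L2_set_def by (simp add: sum.cartesian_product)

lemma frob_norm_triangle:
  assumes "M \<in> carrier_mat n k" "N \<in> carrier_mat n k"
  shows "frob_norm (M + N) \<le> frob_norm M + frob_norm N"
proof -
  have "frob_norm (M + N) = L2_set (\<lambda>p. M $$ p + N $$ p) ({..<n} \<times> {..<k})"
    unfolding frob_norm_L2_set using assms by (intro L2_set_cong) auto
  also have "\<dots> \<le> L2_set (\<lambda>p. M $$ p) ({..<n} \<times> {..<k}) + L2_set (\<lambda>p. N $$ p) ({..<n} \<times> {..<k})"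
    by (rule L2_set_triangle_ineq)
  finally show ?thesis using assms by (simp add: frob_norm_L2_set)
qed

text \<open>The squared norm is a sum over columns, so a bound on the action of \<open>C\<close> on
  single vectors carries over column by column. It is applied with \<open>c = 1\<close> for a
  projection and with \<open>c\<close> a largest singular value.\<close>

lemma frob_norm_mult_le:
  assumes C: "C \<in> carrier_mat m n" and M: "M \<in> carrier_mat n k" and "0 \<le> c"
    and le: "\<And>v. v \<in> carrier_vec n \<Longrightarrow> (C *\<^sub>v v) \<bullet> (C *\<^sub>v v) \<le> c\<^sup>2 * (v \<bullet> v)"
  shows "frob_norm (C * M) \<le> c * frob_norm M"
proof (rule power2_le_imp_le)
  have "(frob_norm (C * M))\<^sup>2 = (\<Sum>j<k. (C *\<^sub>v col M j) \<bullet> (C *\<^sub>v col M j))"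
    unfolding frob_norm_power2_cols using C M by (intro sum.cong) (auto simp: col_mult2[OF C M] simp del: col_mult)
  also have "\<dots> \<le> (\<Sum>j<k. c\<^sup>2 * (col M j \<bullet> col M j))"
    using M by (intro sum_mono le) auto
  also have "\<dots> = (c * frob_norm M)\<^sup>2"
    using M by (simp add: power_mult_distrib frob_norm_power2_cols sum_distrib_left)
  finally show "(frob_norm (C * M))\<^sup>2 \<le> (c * frob_norm M)\<^sup>2" .
qed (use \<open>0 \<le> c\<close> frob_norm_nonneg in simp)

text \<open>The squared norm of \<open>K * M\<close> is the trace of \<open>K (M M^T) K^T\<close>.
  Since \<open>M\<close> and \<open>N\<close> may differ in their number of columns, an
  \<open>n\<close>-column block can be compared with a smaller square root.\<close>

lemma frob_norm_mult_cong_gram: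
  assumes K: "K \<in> carrier_mat m n" and M: "M \<in> carrier_mat n k" and N: "N \<in> carrier_mat n l"
    and eq: "M * transpose_mat M = N * transpose_mat N"
  shows "frob_norm (K * M) = frob_norm (K * N)"
proof -
  have gram: "K * L * transpose_mat (K * L) = K * (L * transpose_mat L) * transpose_mat K"
    if L: "L \<in> carrier_mat n j" for L j
  proof -
    have "transpose_mat (K * L) = transpose_mat L * transpose_mat K"
      using K L by (rule transpose_mult)
    moreover have "K * L * (transpose_mat L * transpose_mat K) = K * (L * (transpose_mat L * transpose_mat K))"
      using K L by (intro assoc_mult_mat[of _ m n _ j _ m]) auto
    moreover have "L * (transpose_mat L * transpose_mat K) = L * transpose_mat L * transpose_mat K"
      using K L by (intro assoc_mult_mat[symmetric, of _ n j _ n _ m]) auto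
    moreover have "K * (L * transpose_mat L * transpose_mat K) = K * (L * transpose_mat L) * transpose_mat K"
      using K L by (intro assoc_mult_mat[symmetric, of _ m n _ n _ m]) auto
    ultimately show ?thesis by simp
  qed
  have "(frob_norm (K * M))\<^sup>2 = (frob_norm (K * N))\<^sup>2"
    unfolding frob_norm_power2_gram gram[OF M] gram[OF N] eq by simp
  then show ?thesis using frob_norm_nonneg by (simp add: power2_eq_iff_nonneg)
qed

section \<open>Rayleigh quotients of symmetric matrices and the largest singular value\<close>

lemma scalar_prod_self:
  fixes v :: "real vec"
  shows "v \<bullet> v = (\<Sum>i<dim_vec v. (v $ i)\<^sup>2)"
  by (simp add: scalar_prod_def power2_eq_square lessThan_atLeast0)

lemma scalar_prod_self_eq_0:
  fixes v :: "real vec"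
  assumes "v \<in> carrier_vec n"
  shows "v \<bullet> v = 0 \<longleftrightarrow> v = 0\<^sub>v n"
  using assms by (auto simp: scalar_prod_self sum_nonneg_eq_0_iff)

text \<open>With \<open>z = T u\<close>, the form along the line \<open>u + t z\<close> equals
  \<open>2 t |z|^2 + t^2 d\<close> where \<open>d \<ge> 0\<close>. For small negative
  \<open>t\<close> this would be negative unless \<open>z = 0\<close>.\<close>

lemma pos_semidef_kernel:
  fixes T :: "real mat"
  assumes T: "T \<in> carrier_mat n n" and sym: "transpose_mat T = T"
    and psd: "\<And>v. v \<in> carrier_vec n \<Longrightarrow> 0 \<le> v \<bullet> (T *\<^sub>v v)"
    and u: "u \<in> carrier_vec n" "u \<bullet> (T *\<^sub>v u) = 0"
  shows "T *\<^sub>v u = 0\<^sub>v n"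
proof -
  define z where "z = T *\<^sub>v u"
  define b where "b = z \<bullet> z"
  define d where "d = z \<bullet> (T *\<^sub>v z)"
  \<comment> \<open>The denominator \<open>d + 1\<close> is positive even if \<open>d = 0\<close>.
    With this choice the form along the line takes the value \<open>- t^2 (d + 2)\<close>.\<close>
  define t where "t = - b / (d + 1)"
  have z: "z \<in> carrier_vec n" unfolding z_def using T u by auto
  have d: "0 \<le> d" unfolding d_def by (rule psd[OF z])
  have uz: "u \<bullet> (T *\<^sub>v z) = b"
    using transpose_vec_mult_scalar[OF T z u(1)] sym unfolding b_def z_def by simp
  have Tz: "T *\<^sub>v z \<in> carrier_vec n" using T z by auto
  have "T *\<^sub>v (u + t \<cdot>\<^sub>v z) = z + t \<cdot>\<^sub>v (T *\<^sub>v z)"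
    using T u z by (simp add: mult_add_distrib_mat_vec[of _ n n] mult_mat_vec[of _ n n] z_def)
  then have "(u + t \<cdot>\<^sub>v z) \<bullet> (T *\<^sub>v (u + t \<cdot>\<^sub>v z)) = u \<bullet> z + t * (u \<bullet> (T *\<^sub>v z)) + (t * (z \<bullet> z) + t * t * d)"
    using u z Tz by (simp add: add_scalar_prod_distrib[of _ n] scalar_prod_add_distrib[of _ n] d_def
        algebra_simps)
  also have "\<dots> = 2 * t * b + t\<^sup>2 * d"
    using u(2) uz by (simp add: b_def[symmetric] z_def[symmetric] power2_eq_square)
  finally have "0 \<le> 2 * t * b + t\<^sup>2 * d" using psd[of "u + t \<cdot>\<^sub>v z"] u z by simp
  moreover have "b = - t * (d + 1)" using d unfolding t_def by simp
  ultimately have "t\<^sup>2 * (d + 2) \<le> 0" by (simp add: algebra_simps power2_eq_square)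
  then have "t = 0" using d by (smt (verit) mult_pos_pos zero_less_power2)
  then have "z \<bullet> z = 0" using d unfolding t_def b_def by auto
  then show ?thesis using scalar_prod_self_eq_0[OF z] unfolding z_def by simp
qed

text \<open>The form attains its maximum \<open>\<mu>\<close> on the unit sphere by compactness. At
  a maximiser \<open>u\<close> the positive semidefinite matrix \<open>\<mu> I - S\<close> has a
  vanishing form, so \<open>u\<close> lies in its kernel and \<open>\<mu>\<close> is an
  eigenvalue.\<close>

lemma symmetric_mat_rayleigh_bound:
  fixes S :: "real mat"
  assumes S: "S \<in> carrier_mat n n" and sym: "transpose_mat S = S" and n: "0 < n"
  obtains \<mu> where "\<mu> \<in> spectrum S" "\<And>v. v \<in> carrier_vec n \<Longrightarrow> v \<bullet> (S *\<^sub>v v) \<le> \<mu> * (v \<bullet> v)"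
proof -
  \<comment> \<open>Vectors are modelled as functions on all naturals, so that the box is compact by
    Tychonoff's theorem and the unit sphere is a closed condition in it. Coordinates from
    \<open>n\<close> on are only confined to the box; \<open>q\<close> ignores them.\<close>
  define K :: "(nat \<Rightarrow> real) set" where "K = Pi UNIV (\<lambda>_. {-1..1}) \<inter> {w. (\<Sum>l<n. (w l)\<^sup>2) = 1}"
  define q where "q w = (\<Sum>i<n. w i * (\<Sum>j<n. S $$ (i, j) * w j))" for w
  have q: "v \<bullet> (S *\<^sub>v v) = q (\<lambda>i. v $ i)" if "v \<in> carrier_vec n" for v
    using S that unfolding q_def by (simp add: scalar_prod_def lessThan_atLeast0)
  have cont: "continuous_on A (\<lambda>w. w j)" for j :: nat and A :: "(nat \<Rightarrow> real) set"
    by (rule continuous_on_subset[OF continuous_on_product_coordinates]) simp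
  have "compactin (product_topology (\<lambda>_. euclidean) UNIV) (PiE UNIV (\<lambda>_::nat. {-1..1::real}))"
    by (subst compactin_PiE) auto
  then have "compact (Pi UNIV (\<lambda>_::nat. {-1..1::real}))"
    by (simp add: euclidean_product_topology PiE_UNIV_domain)
  moreover have "closed {w. (\<Sum>l<n. (w l)\<^sup>2) = (1::real)}"
    by (intro closed_Collect_eq continuous_intros cont)
  ultimately have comp: "compact K" unfolding K_def by (rule compact_Int_closed)
  have "(\<Sum>l<n. (if l = 0 then 1 else 0 :: real)\<^sup>2) = 1"
    using n by (simp add: if_distrib[of "\<lambda>x. x\<^sup>2"] cong: if_cong)
  then have "(\<lambda>l. if l = 0 then 1 else 0) \<in> K" unfolding K_def by auto
  then have "K \<noteq> {}" by blast
  moreover have "continuous_on K q" unfolding q_def by (intro continuous_intros cont)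
  ultimately obtain w0 where w0: "w0 \<in> K" "\<And>w. w \<in> K \<Longrightarrow> q w \<le> q w0"
    using continuous_attains_sup[OF comp] by blast
  define \<mu> where "\<mu> = q w0"
  have bound: "v \<bullet> (S *\<^sub>v v) \<le> \<mu> * (v \<bullet> v)" if v: "v \<in> carrier_vec n" for v
  proof (cases "v \<bullet> v = 0")
    case True
    then show ?thesis using scalar_prod_self_eq_0[OF v] S by simp
  next
    case False
    define s where "s = sqrt (v \<bullet> v)"
    have vv: "v \<bullet> v = (\<Sum>i<n. (v $ i)\<^sup>2)" using scalar_prod_self[of v] v by simp
    then have "0 \<le> v \<bullet> v" by (simp add: sum_nonneg)
    with False have s: "s\<^sup>2 = v \<bullet> v" "s > 0" unfolding s_def by auto
    \<comment> \<open>Normalising \<open>v\<close> gives a point of the sphere; the value 0 beyond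
      \<open>n\<close> keeps it in the box.\<close>
    define w where "w i = (if i < n then v $ i / s else 0)" for i
    have "(\<Sum>i<n. (w i)\<^sup>2) = (\<Sum>i<n. (v $ i)\<^sup>2) / s\<^sup>2"
      unfolding w_def sum_divide_distrib by (intro sum.cong) (auto simp: power_divide)
    also have "\<dots> = 1" using s False vv by simp
    finally have sum1: "(\<Sum>i<n. (w i)\<^sup>2) = 1" .
    have "w i \<in> {-1..1}" for i
    proof (cases "i < n")
      case True
      then have "(w i)\<^sup>2 \<le> (\<Sum>i<n. (w i)\<^sup>2)" by (intro member_le_sum) auto
      then have "\<bar>w i\<bar> \<le> 1" using sum1 by (simp add: abs_square_le_1)
      then show ?thesis by auto
    qed (simp add: w_def)
    with sum1 have "w \<in> K" unfolding K_def by auto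
    then have "q w \<le> \<mu>" unfolding \<mu>_def by (rule w0)
    moreover have "q (\<lambda>i. v $ i) = s\<^sup>2 * q w"
      using s unfolding q_def w_def sum_distrib_left
      by (intro sum.cong) (auto simp: power2_eq_square)
    ultimately show ?thesis unfolding q[OF v] s(1)[symmetric]
      using \<open>0 \<le> v \<bullet> v\<close> s by (simp add: mult.commute mult_right_mono)
  qed
  define u where "u = vec n w0"
  have u: "u \<in> carrier_vec n" unfolding u_def by simp
  have uu: "u \<bullet> u = 1" using scalar_prod_self[of u] w0(1) unfolding u_def K_def by simp
  have qu: "u \<bullet> (S *\<^sub>v u) = \<mu>" unfolding q[OF u] \<mu>_def unfolding u_def q_def by simp
  define T where "T = \<mu> \<cdot>\<^sub>m 1\<^sub>m n - S"
  have T: "T \<in> carrier_mat n n" unfolding T_def using S by (intro minus_carrier_mat)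
  have Tv: "T *\<^sub>v v = \<mu> \<cdot>\<^sub>v v - S *\<^sub>v v" if v: "v \<in> carrier_vec n" for v
  proof -
    have "(\<mu> \<cdot>\<^sub>m 1\<^sub>m n) *\<^sub>v v = \<mu> \<cdot>\<^sub>v v"
      using v by (intro eq_vecI) (auto simp: scalar_prod_def if_distrib if_distribR cong: if_cong)
    then show ?thesis
      unfolding T_def using S v by (subst minus_mult_distrib_mat_vec[of _ n n]) auto
  qed
  have vTv: "v \<bullet> (T *\<^sub>v v) = \<mu> * (v \<bullet> v) - v \<bullet> (S *\<^sub>v v)" if v: "v \<in> carrier_vec n" for v
    unfolding Tv[OF v] using S v by (subst scalar_prod_minus_distrib[of _ n]) auto
  have "transpose_mat T = T" unfolding T_def using S sym
    by (intro eq_matI) (auto, metis index_transpose_mat(1) carrier_matD)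
  then have "T *\<^sub>v u = 0\<^sub>v n"
    by (rule pos_semidef_kernel[OF T _ _ u]) (use vTv bound u uu qu in auto)
  then have "\<mu> \<cdot>\<^sub>v u - S *\<^sub>v u = 0\<^sub>v n" using Tv[OF u] by simp
  then have "S *\<^sub>v u = \<mu> \<cdot>\<^sub>v u"
    using S u by (auto simp: vec_eq_iff)
  moreover have "u \<noteq> 0\<^sub>v n" using uu by auto
  ultimately have "\<mu> \<in> spectrum S"
    unfolding spectrum_def eigenvalue_def eigenvector_def using S u by auto
  then show thesis using bound by (rule that)
qed

text \<open>The form of \<open>M^T M\<close> at \<open>v\<close> is \<open>|M v|^2\<close>, so the
  Rayleigh bound applies. Its eigenvalue \<open>\<mu>\<close> satisfies
  \<open>sqrt \<mu> \<le> sigma_max M\<close>, because \<open>sigma_max\<close> is a maximum over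
  the finite spectrum, which \<open>0 < n\<close> makes nonempty.\<close>

lemma mult_mat_vec_le_sigma_max:
  assumes M: "M \<in> carrier_mat m n" and n: "0 < n"
  shows sigma_max_nonneg: "0 \<le> sigma_max M"
    and "v \<in> carrier_vec n \<Longrightarrow> (M *\<^sub>v v) \<bullet> (M *\<^sub>v v) \<le> (sigma_max M)\<^sup>2 * (v \<bullet> v)"
proof -
  let ?S = "transpose_mat M * M"
  have S: "?S \<in> carrier_mat n n" using M by simp
  have "transpose_mat ?S = ?S" using M by (subst transpose_mult[of _ n m _ n]) auto
  then obtain \<mu> where \<mu>: "\<mu> \<in> spectrum ?S"
    and le: "\<And>v. v \<in> carrier_vec n \<Longrightarrow> v \<bullet> (?S *\<^sub>v v) \<le> \<mu> * (v \<bullet> v)"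
    using symmetric_mat_rayleigh_bound[OF S _ n] by blast
  have quad: "v \<bullet> (?S *\<^sub>v v) = (M *\<^sub>v v) \<bullet> (M *\<^sub>v v)" if v: "v \<in> carrier_vec n" for v
  proof -
    have "?S *\<^sub>v v = transpose_mat M *\<^sub>v (M *\<^sub>v v)" using M v by (intro assoc_mult_mat_vec) auto
    then show ?thesis using transpose_vec_mult_scalar[OF M v, of "M *\<^sub>v v"] M v
      by (simp add: comm_scalar_prod[of v n])
  qed
  have self_nonneg: "0 \<le> u \<bullet> u" for u :: "real vec"
    by (simp add: scalar_prod_self sum_nonneg)
  \<comment> \<open>Testing the bound on a unit vector gives the sign of \<open>\<mu>\<close>,
    needed to square \<open>sqrt \<mu>\<close> back to \<open>\<mu>\<close>.\<close>
  have "0 \<le> \<mu>"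
  proof -
    have "0 \<le> \<mu> * (unit_vec n 0 \<bullet> unit_vec n 0)"
      using le[of "unit_vec n 0"] quad[of "unit_vec n 0"] self_nonneg[of "M *\<^sub>v unit_vec n 0"] by simp
    then show ?thesis using n by simp
  qed
  have "sqrt \<mu> \<le> sigma_max M" unfolding sigma_max_def
    using card_finite_spectrum(1)[OF S] \<mu> by (intro Max_ge) auto
  with \<open>0 \<le> \<mu>\<close> show nonneg: "0 \<le> sigma_max M" by (meson order_trans real_sqrt_ge_zero)
  have "\<mu> \<le> (sigma_max M)\<^sup>2"
    using \<open>sqrt \<mu> \<le> sigma_max M\<close> \<open>0 \<le> \<mu>\<close> by (metis real_sqrt_pow2 power_mono real_sqrt_ge_zero)
  then show "(M *\<^sub>v v) \<bullet> (M *\<^sub>v v) \<le> (sigma_max M)\<^sup>2 * (v \<bullet> v)" if v: "v \<in> carrier_vec n"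
    using le[OF v] quad[OF v] self_nonneg[of v] by (smt (verit) mult_right_mono)
qed

section \<open>Stable invariant subspace of the Hamiltonian\<close>

text \<open>A one-sided inverse of a square matrix is two-sided, so \<open>mat_inverse\<close> does
  not return \<open>None\<close>, and inverses are unique.\<close>

lemma minv_unique:
  assumes A: "A \<in> carrier_mat n n" and B: "B \<in> carrier_mat n n" and AB: "A * B = 1\<^sub>m n"
  shows "minv A = B"
proof -
  have BA: "B * A = 1\<^sub>m n" using mat_mult_left_right_inverse[OF A B AB] .
  have "A \<in> Units (ring_mat TYPE(real) n undefined)"
    unfolding Units_def ring_mat_def using A B AB BA by auto
  then obtain C where C: "mat_inverse A = Some C" using mat_inverse(1)[OF A, where b = undefined]
    by (cases "mat_inverse A") auto
  from mat_inverse(2)[OF A C] have "C * A = 1\<^sub>m n" and Cc: "C \<in> carrier_mat n n" by auto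
  then have "C = C * (A * B)" using AB by simp
  also have "\<dots> = C * A * B" using A B Cc by (intro assoc_mult_mat[symmetric]) auto
  also have "\<dots> = B" using \<open>C * A = 1\<^sub>m n\<close> B by simp
  finally show ?thesis using C by simp
qed

section \<open>Stacked matrices and the graph of the Riccati solution\<close>

lemma append_rows_mult:
  assumes "U \<in> carrier_mat m n" "V \<in> carrier_mat l n" "L \<in> carrier_mat n k"
  shows "(U @\<^sub>r V) * L = (U * L) @\<^sub>r (V * L)"
  using assms unfolding append_rows_def
  by (intro eq_matI) (auto simp: scalar_prod_def)

lemma four_block_mult_append_rows:
  assumes "A \<in> carrier_mat m n" "B \<in> carrier_mat m l" "C \<in> carrier_mat k n" "D \<in> carrier_mat k l"
    and "U \<in> carrier_mat n j" "V \<in> carrier_mat l j"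
  shows "four_block_mat A B C D * (U @\<^sub>r V) = (A * U + B * V) @\<^sub>r (C * U + D * V)"
  unfolding append_rows_def using assms
  by (subst mult_four_block_mat[of _ m n _ l _ k _ _ j _ 0]) auto

lemma append_rows_inject:
  assumes c: "U \<in> carrier_mat m n" "V \<in> carrier_mat l n" "U' \<in> carrier_mat m n" "V' \<in> carrier_mat l n"
    and eq: "U @\<^sub>r V = U' @\<^sub>r V'"
  shows "U = U'" "V = V'"
proof -
  have U: "(U @\<^sub>r V) $$ (i, j) = U $$ (i, j)" "(U' @\<^sub>r V') $$ (i, j) = U' $$ (i, j)" if "i < m" "j < n" for i j
    using c that by (auto simp: append_rows_def)
  have V: "(U @\<^sub>r V) $$ (m + i, j) = V $$ (i, j)" "(U' @\<^sub>r V') $$ (m + i, j) = V' $$ (i, j)"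
    if "i < l" "j < n" for i j
    using c that by (auto simp: append_rows_def)
  show "U = U'" using U eq c by (intro eq_matI) auto
  show "V = V'" using V eq c by (intro eq_matI) auto
qed

text \<open>The lower block of the product is \<open>- Q - A^T X\<close>, which the Riccati equation
  turns into \<open>X (A - G X)\<close>. Thus the graph of \<open>X\<close> is invariant, and the
  Hamiltonian acts on it as the closed-loop matrix.\<close>

lemma hamiltonian_mult_riccati:
  assumes A: "A \<in> carrier_mat n n" and G: "G \<in> carrier_mat n n" and Q: "Q \<in> carrier_mat n n"
    and X: "X \<in> carrier_mat n n"
    and ric: "transpose_mat A * X + X * A + Q - X * G * X = 0\<^sub>m n n"
  shows "hamiltonian A G Q * (1\<^sub>m n @\<^sub>r X) = (1\<^sub>m n @\<^sub>r X) * (A - G * X)"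
proof -
  have "hamiltonian A G Q * (1\<^sub>m n @\<^sub>r X)
      = (A * 1\<^sub>m n + (- G) * X) @\<^sub>r ((- Q) * 1\<^sub>m n + (- transpose_mat A) * X)"
    unfolding hamiltonian_def using A G Q X by (intro four_block_mult_append_rows) auto
  also have "A * 1\<^sub>m n + (- G) * X = 1\<^sub>m n * (A - G * X)"
    using A G X by (simp add: minus_add_uminus_mat[of _ n n])
  also have "(- Q) * 1\<^sub>m n + (- transpose_mat A) * X = X * (A - G * X)"
  proof -
    have "X * (A - G * X) = X * A - X * G * X"
      using A G X by (simp add: mult_minus_distrib_mat[of _ n n _ n] assoc_mult_mat[of _ n n _ n _ n])
    moreover have "(X * A - X * G * X) $$ (i, j) = (- Q - transpose_mat A * X) $$ (i, j)"
      if "i < n" "j < n" for i j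
    proof -
      have "(transpose_mat A * X + X * A + Q - X * G * X) $$ (i, j) = 0" using ric that by simp
      then show ?thesis using A G Q X that by simp
    qed
    then have "X * A - X * G * X = - Q - transpose_mat A * X"
      using A G Q X by (intro eq_matI) auto
    moreover have "- Q * 1\<^sub>m n + (- transpose_mat A) * X = - Q - transpose_mat A * X"
      using A Q X by (simp add: minus_add_uminus_mat[of _ n n])
    ultimately show ?thesis by simp
  qed
  also have "(1\<^sub>m n * (A - G * X)) @\<^sub>r (X * (A - G * X)) = (1\<^sub>m n @\<^sub>r X) * (A - G * X)"
    using A G X by (intro append_rows_mult[symmetric]) auto
  finally show ?thesis .
qed

section \<open>Column spans and the stable subspace\<close>

lemma column_span_eq:
  assumes "V \<in> carrier_mat N k"
  shows "column_span V = {V *\<^sub>v x | x. x \<in> carrier_vec k}"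
proof -
  interpret vec_space "TYPE(real)" N .
  have "column_span V = col_space V" unfolding column_span_def col_space_def using assms by simp
  also have "\<dots> = {V *\<^sub>v x | x. x \<in> carrier_vec k}" unfolding col_space_eq[OF assms] using assms by auto
  finally show ?thesis .
qed

text \<open>The coefficient vectors of the columns of \<open>W\<close> are collected as the columns
  of \<open>T\<close>.\<close>

lemma factor_through_column_span:
  assumes W: "W \<in> carrier_mat N n" and V: "V \<in> carrier_mat N k"
    and span: "\<And>j. j < n \<Longrightarrow> col W j \<in> column_span V"
  obtains T where "T \<in> carrier_mat k n" "W = V * T"
proof -
  from span have "\<forall>j\<in>{..<n}. \<exists>x. x \<in> carrier_vec k \<and> col W j = V *\<^sub>v x"
    unfolding column_span_eq[OF V] by blast
  then obtain x where x: "\<And>j. j < n \<Longrightarrow> x j \<in> carrier_vec k" "\<And>j. j < n \<Longrightarrow> col W j = V *\<^sub>v x j"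
    unfolding bchoice_iff by auto
  define T where "T = mat k n (\<lambda>(i, j). x j $ i)"
  have T: "T \<in> carrier_mat k n" unfolding T_def by simp
  have "col T j = x j" if "j < n" for j
    using x(1)[OF that] that unfolding T_def by (intro eq_vecI) auto
  then have "W = V * T"
    using W V T x(2) by (intro mat_col_eqI) (auto simp: col_mult2[of _ N k _ n] simp del: col_mult)
  with T show thesis by (rule that)
qed

text \<open>In an eigenbasis \<open>S\<close> of \<open>H\<close>, the coordinate matrix
  \<open>U\<close> of \<open>W\<close> satisfies \<open>D U = U F\<close>. Each nonzero row of
  \<open>U\<close> is then a left eigenvector of \<open>F\<close>, so its eigenvalue has negative
  real part. Hence \<open>W = S U\<close> involves only stable eigenvectors.\<close>

lemma hurwitz_invariant_in_stable_subspace: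
  assumes H: "H \<in> carrier_mat N N" and diag: "diagonalizable H"
    and W: "W \<in> carrier_mat N n" and F: "F \<in> carrier_mat n n" and hur: "hurwitz F"
    and inv: "H * W = W * F" and j: "j < n"
  shows "col W j \<in> stable_subspace H"
proof -
  interpret vec_space "TYPE(complex)" N .
  let ?H = "cmat H" and ?W = "cmat W" and ?F = "cmat F"
  define E where "E = (\<Union>z \<in> {z \<in> spectrum ?H. Re z < 0}. \<Union>k. mat_kernel (char_matrix ?H z ^\<^sub>m k))"
  have cH: "?H \<in> carrier_mat N N" and cW: "?W \<in> carrier_mat N n" and cF: "?F \<in> carrier_mat n n"
    using H W F by auto
  have E: "E \<subseteq> carrier_vec N"
    unfolding E_def using cH mat_kernel_carrier[OF pow_carrier_mat[OF char_matrix_closed[OF cH]]] by blast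
  obtain D where D: "diagonal_mat D" "similar_mat ?H D" using diag unfolding diagonalizable_def by blast
  obtain S T where Dc: "D \<in> carrier_mat N N" and S: "S \<in> carrier_mat N N" and T: "T \<in> carrier_mat N N"
    and ST: "S * T = 1\<^sub>m N" and TS: "T * S = 1\<^sub>m N" and HS: "?H = S * D * T"
    using D(2) cH unfolding similar_mat_def similar_mat_wit_def Let_def by auto
  have HS': "?H * S = S * D"
    unfolding HS using S D T TS Dc by (simp add: assoc_mult_mat[of _ N N _ N _ N])
  have SD: "S * D = mat N N (\<lambda>(k, i). D $$ (i, i) * S $$ (k, i))"
  proof (rule eq_matI)
    fix k i assume "k < dim_row (mat N N (\<lambda>(k, i). D $$ (i, i) * S $$ (k, i)))"
      "i < dim_col (mat N N (\<lambda>(k, i). D $$ (i, i) * S $$ (k, i)))"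
    then have ki: "k < N" "i < N" by auto
    have "(S * D) $$ (k, i) = (\<Sum>l<N. S $$ (k, l) * D $$ (l, i))"
      using S Dc ki by (simp add: scalar_prod_def lessThan_atLeast0)
    also have "\<dots> = (\<Sum>l<N. if l = i then D $$ (i, i) * S $$ (k, i) else 0)"
      using D(1) Dc ki unfolding diagonal_mat_def by (intro sum.cong) auto
    finally show "(S * D) $$ (k, i) = mat N N (\<lambda>(k, i). D $$ (i, i) * S $$ (k, i)) $$ (k, i)"
      using ki by simp
  qed (use S Dc in auto)
  have eig: "eigenvector ?H (col S i) (D $$ (i, i))" if i: "i < N" for i
  proof -
    have "?H *\<^sub>v col S i = col (S * D) i"
      unfolding HS'[symmetric] using cH S i by (simp add: col_mult2[of _ N N _ N] del: col_mult)
    also have "\<dots> = D $$ (i, i) \<cdot>\<^sub>v col S i" unfolding SD using S i by (intro eq_vecI) auto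
    finally have "?H *\<^sub>v col S i = D $$ (i, i) \<cdot>\<^sub>v col S i" .
    moreover have "col S i \<noteq> 0\<^sub>v N"
    proof
      assume "col S i = 0\<^sub>v N"
      then have "col (T * S) i = 0\<^sub>v N" using T S i by (auto simp: col_mult2[of _ N N _ N] simp del: col_mult)
      then have "unit_vec N i = (0\<^sub>v N :: complex vec)" using TS i by simp
      then have "unit_vec N i $ i = (0\<^sub>v N :: complex vec) $ i" by simp
      then show False using i by simp
    qed
    ultimately show ?thesis unfolding eigenvector_def using S cH i by auto
  qed
  have colE: "col S i \<in> E" if i: "i < N" and "Re (D $$ (i, i)) < 0" for i
  proof -
    let ?C = "char_matrix ?H (D $$ (i, i))"
    \<comment> \<open>Ordinary eigenvectors are the generalized ones with exponent 1.\<close>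
    have "?C ^\<^sub>m 1 = ?C" using cH by (simp add: char_matrix_def)
    moreover have "col S i \<in> mat_kernel ?C"
      using eig[OF i] cH S i unfolding eigenvector_char_matrix[OF cH]
      by (intro mat_kernelI[of _ N N]) auto
    ultimately have "col S i \<in> mat_kernel (?C ^\<^sub>m 1)" by simp
    moreover have "D $$ (i, i) \<in> spectrum ?H"
      using eig[OF i] unfolding spectrum_def eigenvalue_def by auto
    ultimately show ?thesis unfolding E_def using that(2) by blast
  qed
  define U where "U = T * ?W"
  have U: "U \<in> carrier_mat N n" unfolding U_def using T cW by simp
  have WU: "?W = S * U"
    unfolding U_def using assoc_mult_mat[OF S T cW] ST cW by simp
  have invc: "?H * ?W = ?W * ?F"
    using of_real_hom.mat_hom_mult[OF H W] of_real_hom.mat_hom_mult[OF W F] inv by metis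
  have DU: "D * U = U * ?F"
  proof -
    have "D * U = (T * S) * (D * (T * ?W))" unfolding TS U_def using Dc T cW by simp
    also have "\<dots> = T * (?H * ?W)"
      unfolding HS using Dc S T cW by (simp add: assoc_mult_mat[of _ N N _ N _ N] assoc_mult_mat[of _ N N _ N _ n])
    also have "\<dots> = U * ?F" unfolding invc U_def using assoc_mult_mat[OF T cW cF] by simp
    finally show ?thesis .
  qed
  \<comment> \<open>The rows of \<open>U\<close> are left eigenvectors of the Hurwitz matrix \<open>F\<close>.\<close>
  have row0: "row U i = 0\<^sub>v n" if i: "i < N" and re: "\<not> Re (D $$ (i, i)) < 0" for i
  proof (rule ccontr)
    assume ne: "row U i \<noteq> 0\<^sub>v n"
    have "transpose_mat ?F *\<^sub>v row U i = D $$ (i, i) \<cdot>\<^sub>v row U i"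
    proof (rule eq_vecI)
      fix l assume "l < dim_vec (D $$ (i, i) \<cdot>\<^sub>v row U i)"
      then have l: "l < n" using U by simp
      have "(transpose_mat ?F *\<^sub>v row U i) $ l = (U * ?F) $$ (i, l)"
        using cF U i l by (simp add: comm_scalar_prod[of _ n])
      also have "\<dots> = (D * U) $$ (i, l)" using DU by simp
      also have "\<dots> = (\<Sum>k<N. D $$ (i, k) * U $$ (k, l))"
        using Dc U i l by (simp add: scalar_prod_def lessThan_atLeast0)
      also have "\<dots> = (\<Sum>k<N. if k = i then D $$ (i, i) * U $$ (i, l) else 0)"
        using D(1) Dc i unfolding diagonal_mat_def by (intro sum.cong) auto
      finally show "(transpose_mat ?F *\<^sub>v row U i) $ l = (D $$ (i, i) \<cdot>\<^sub>v row U i) $ l"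
        using U i l by simp
    qed (use cF U in auto)
    then have "eigenvalue (transpose_mat ?F) (D $$ (i, i))"
      unfolding eigenvalue_def eigenvector_def using ne U cF i by (intro exI[of _ "row U i"]) auto
    \<comment> \<open>A matrix and its transpose share their characteristic polynomial.\<close>
    then have "eigenvalue ?F (D $$ (i, i))"
      using eigenvalue_root_char_poly[OF cF] eigenvalue_root_char_poly[OF transpose_carrier_mat[THEN iffD2, OF cF]]
        char_poly_transpose_mat[OF cF] by simp
    then show False using hur re unfolding hurwitz_def spectrum_def by auto
  qed
  \<comment> \<open>Erasing the unstable columns of \<open>S\<close> does not change the product
    with \<open>U\<close>, since they only meet zero rows. What remains is a stable eigenvector or
    zero in each column.\<close>
  define S' where "S' = mat N N (\<lambda>(k, i). if Re (D $$ (i, i)) < 0 then S $$ (k, i) else 0)"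
  have S': "S' \<in> carrier_mat N N" unfolding S'_def by simp
  have "?W = S' * U"
  proof (unfold WU, rule eq_matI)
    fix k l assume "k < dim_row (S' * U)" "l < dim_col (S' * U)"
    then have kl: "k < N" "l < n" using S' U by auto
    have "S $$ (k, i) * U $$ (i, l) = S' $$ (k, i) * U $$ (i, l)" if i: "i < N" for i
    proof (cases "Re (D $$ (i, i)) < 0")
      case False
      have "U $$ (i, l) = row U i $ l" using U i kl by simp
      then show ?thesis using row0[OF i False] kl by simp
    qed (use i kl in \<open>simp add: S'_def\<close>)
    then show "(S * U) $$ (k, l) = (S' * U) $$ (k, l)"
      using S S' U kl by (auto simp: scalar_prod_def intro!: sum.cong)
  qed (use S S' U in auto)
  then have "col ?W j = S' *\<^sub>v col U j" using S' U j by (simp add: col_mult2[of _ N N _ n] del: col_mult)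
  moreover have "col U j \<in> carrier_vec N" using U by auto
  ultimately have "col ?W j \<in> col_space S'" unfolding col_space_eq[OF S'] using S' by auto
  also have "col_space S' \<subseteq> span E" unfolding col_space_def
  proof (rule span_is_subset)
    show "submodule class_ring (span E) V" using span_is_submodule[of E] E by simp
    show "set (cols S') \<subseteq> span E"
    proof
      fix v assume "v \<in> set (cols S')"
      then obtain i where i: "i < N" "v = col S' i" using S' by (auto simp: cols_def)
      show "v \<in> span E"
      proof (cases "Re (D $$ (i, i)) < 0")
        case True
        then have "v = col S i" unfolding i(2) S'_def using S i(1) by (intro eq_vecI) auto
        then show ?thesis using colE[OF i(1) True] in_own_span[of E] E by auto
      next
        case False
        then have "v = 0\<^sub>v N" unfolding i(2) S'_def using i(1) by (intro eq_vecI) auto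
        then show ?thesis using span_zero by simp
      qed
    qed
  qed
  finally have "col ?W j \<in> span E" .
  moreover have "col ?W j = map_vec complex_of_real (col W j)" using W j by (intro eq_vecI) auto
  ultimately show ?thesis
    unfolding stable_subspace_def E_def using H W j by auto
qed

text \<open>Invertibility of \<open>Y\<close> is a conclusion: the upper block of the factorisation
  \<open>[I; X] = [Y; Z] T\<close> reads \<open>Y T = I\<close>, the lower one
  \<open>Z T = X\<close>.\<close>

lemma stable_eigenvectors_riccati:
  assumes A: "A \<in> carrier_mat n n" and G: "G \<in> carrier_mat n n" and Q: "Q \<in> carrier_mat n n"
    and X: "stabilizing_riccati_solution A Q G X"
    and diag: "diagonalizable (hamiltonian A G Q)"
    and Y: "Y \<in> carrier_mat n n" and Z: "Z \<in> carrier_mat n n" and L: "L \<in> carrier_mat n n"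
    and span: "column_span (Y @\<^sub>r Z) = stable_subspace (hamiltonian A G Q)"
    and eig: "hamiltonian A G Q * (Y @\<^sub>r Z) = (Y @\<^sub>r Z) * L"
  obtains T where "T \<in> carrier_mat n n" "Y * T = 1\<^sub>m n" "T * Y = 1\<^sub>m n" "(A - G * X) * Y = Y * L"
proof -
  let ?H = "hamiltonian A G Q"
  have Xc: "X \<in> carrier_mat n n"
    and ric: "transpose_mat A * X + X * A + Q - X * G * X = 0\<^sub>m n n"
    and hur: "hurwitz (A - G * X)"
    using X A unfolding stabilizing_riccati_solution_def by auto
  have H: "?H \<in> carrier_mat (n + n) (n + n)" unfolding hamiltonian_def using A Q G by auto
  have F: "A - G * X \<in> carrier_mat n n" using A G Xc by auto
  have IX: "1\<^sub>m n @\<^sub>r X \<in> carrier_mat (n + n) n" and YZ: "Y @\<^sub>r Z \<in> carrier_mat (n + n) n"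
    using Xc Y Z by auto
  have "col (1\<^sub>m n @\<^sub>r X) j \<in> column_span (Y @\<^sub>r Z)" if "j < n" for j
    unfolding span
    by (rule hurwitz_invariant_in_stable_subspace[OF H diag IX F hur
          hamiltonian_mult_riccati[OF A G Q Xc ric] that])
  then obtain T where T: "T \<in> carrier_mat n n" and fac: "1\<^sub>m n @\<^sub>r X = (Y @\<^sub>r Z) * T"
    using factor_through_column_span[OF IX YZ] by blast
  have fac': "1\<^sub>m n @\<^sub>r X = (Y * T) @\<^sub>r (Z * T)"
    unfolding fac using Y Z T by (rule append_rows_mult)
  have YT: "Y * T = 1\<^sub>m n" and ZT: "Z * T = X"
    using append_rows_inject[of "1\<^sub>m n" n n X n, OF _ _ _ _ fac'] Xc Y Z T by auto
  have TY: "T * Y = 1\<^sub>m n" using mat_mult_left_right_inverse[OF Y T YT] .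
  \<comment> \<open>This eliminates \<open>Z\<close> from the upper block row of the Hamiltonian
    relation, which then becomes \<open>(A - G X) Y = Y L\<close>.\<close>
  have XY: "X * Y = Z"
    unfolding ZT[symmetric] using assoc_mult_mat[OF Z T Y] TY Z by simp
  have "(A * Y + (- G) * Z) @\<^sub>r ((- Q) * Y + (- transpose_mat A) * Z) = (Y * L) @\<^sub>r (Z * L)"
    using eig append_rows_mult[OF Y Z L]
      four_block_mult_append_rows[of A n n "- G" n "- Q" n "- transpose_mat A", OF _ _ _ _ Y Z] A G Q
    unfolding hamiltonian_def by simp
  then have top: "A * Y + (- G) * Z = Y * L"
    by (rule append_rows_inject(1)[of _ n n _ n, rotated 4]) (use A G Q Y Z L in auto)
  have "(A - G * X) * Y = A * Y - G * X * Y"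
    using A G Xc Y by (intro minus_mult_distrib_mat) auto
  also have "G * X * Y = G * Z" using assoc_mult_mat[OF G Xc Y] XY by simp
  also have "A * Y - G * Z = Y * L"
    unfolding top[symmetric] using A G Y Z by (simp add: minus_add_uminus_mat[of _ n n])
  finally show thesis by (rule that[OF T YT TY])
qed

text \<open>Multiplying the Lyapunov equation by \<open>T\<close> and its transpose gives
  \<open>L M + M L + N = 0\<close> with \<open>L\<close> diagonal. Entry by entry this is a scalar
  equation, and solving it produces the Cauchy matrix.\<close>

lemma lyapunov_eigencoordinates:
  fixes F :: "real mat"
  assumes F: "F \<in> carrier_mat n n" and \<Phi>: "\<Phi> \<in> carrier_mat n n" and B: "B \<in> carrier_mat n k"
    and lyap: "F * \<Phi> + \<Phi> * transpose_mat F + B * transpose_mat B = 0\<^sub>m n n"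
    and Y: "Y \<in> carrier_mat n n" and T: "T \<in> carrier_mat n n" and YT: "Y * T = 1\<^sub>m n"
    and TY: "T * Y = 1\<^sub>m n" and eig: "F * Y = Y * mat_diag n lam"
    and ij: "i < n" "j < n" and ne: "lam i + lam j \<noteq> 0"
  shows "(T * \<Phi> * transpose_mat T) $$ (i, j)
    = - (T * B * transpose_mat (T * B)) $$ (i, j) / (lam i + lam j)"
proof -
  define M where "M = T * \<Phi> * transpose_mat T"
  define N where "N = T * B * transpose_mat (T * B)"
  define Tt where "Tt = transpose_mat T"
  define Ft where "Ft = transpose_mat F"
  define W where "W = B * transpose_mat B"
  define L where "L = mat_diag n lam"
  have eig': "F * Y = Y * L" using eig unfolding L_def .
  have c: "Tt \<in> carrier_mat n n" "Ft \<in> carrier_mat n n" "W \<in> carrier_mat n n"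
    "L \<in> carrier_mat n n" "M \<in> carrier_mat n n"
    unfolding Tt_def Ft_def W_def M_def L_def using F \<Phi> T B by auto
  note assoc = assoc_mult_mat[of _ n n _ n _ n]
  have LT: "L * T \<in> carrier_mat n n" and TFc: "T * F \<in> carrier_mat n n" using F T c by auto
  \<comment> \<open>Inserting \<open>Y T = I\<close> turns the right eigenvector relation into a
    left one: the rows of \<open>T\<close> are left eigenvectors of \<open>F\<close>.\<close>
  have "T * F = T * F * (Y * T)" using right_mult_one_mat[OF TFc] YT by simp
  also have "\<dots> = T * (F * Y) * T" using F T Y by (simp add: assoc)
  also have "\<dots> = T * Y * (L * T)"
    unfolding eig' using T Y c(4) assoc[OF T Y LT] by (simp add: assoc)
  finally have TF: "T * F = L * T" using left_mult_one_mat[OF LT] TY by simp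
  have "transpose_mat (T * F) = Ft * Tt" unfolding Ft_def Tt_def using T F by (rule transpose_mult)
  moreover have "transpose_mat (L * T) = Tt * L"
    unfolding Tt_def using T c by (subst transpose_mult[of _ n n _ n]) (auto simp: L_def mat_diag_def intro!: eq_matI arg_cong2[of _ _ _ _ "(*)"])
  ultimately have FT: "Ft * Tt = Tt * L" using TF by simp
  have N: "N = T * W * Tt"
    unfolding N_def W_def Tt_def using T B
    by (simp add: transpose_mult[of _ n n _ k] assoc_mult_mat[of _ n n _ k _ n]
        assoc_mult_mat[of _ n k _ n _ n] assoc_mult_mat[of _ n n _ n _ n])
  have "T * (F * \<Phi> + \<Phi> * Ft + W) * Tt = T * F * \<Phi> * Tt + T * \<Phi> * (Ft * Tt) + T * W * Tt"
    using F \<Phi> T c by (simp add: add_mult_distrib_mat[of _ n n _ _ n] mult_add_distrib_mat[of _ n n _ n] assoc)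
  also have "\<dots> = L * M + M * L + N"
    unfolding TF FT N M_def Tt_def[symmetric] using F \<Phi> T c by (simp add: assoc)
  also have "T * (F * \<Phi> + \<Phi> * Ft + W) * Tt = 0\<^sub>m n n"
    using lyap T c unfolding Ft_def W_def by simp
  finally have "(L * M + M * L + N) $$ (i, j) = 0" using ij by (metis index_zero_mat(1))
  then have "lam i * M $$ (i, j) + M $$ (i, j) * lam j + N $$ (i, j) = 0"
    using ij c T B by (simp add: N_def L_def mat_diag_mult_left[of _ n n] mat_diag_mult_right[of _ n n])
  then have "M $$ (i, j) * (lam i + lam j) = - N $$ (i, j)" by (simp add: algebra_simps)
  then show ?thesis using ne unfolding M_def[symmetric] N_def[symmetric] by (simp add: field_simps)
qed

section \<open>Clustering-based projections\<close>

text \<open>The rows are orthonormal: disjoint clusters give disjoint supports, and each row is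
  normalised by a norm that is positive because \<open>w\<close> does not vanish on any
  cluster.\<close>

lemma clustering_proj_gram:
  assumes P: "P \<in> clustering_projs n r"
  shows "P \<in> carrier_mat r n" and "P * transpose_mat P = 1\<^sub>m r"
proof -
  obtain I w where Pdef: "P = clustering_proj n r I w" and I: "is_clustering n r I"
    and w: "\<And>i. i < r \<Longrightarrow> \<exists>j\<in>I i. w $ j \<noteq> 0"
    using P unfolding clustering_projs_def by auto
  show Pc: "P \<in> carrier_mat r n" unfolding Pdef clustering_proj_def by simp
  have sub: "I i \<subseteq> {..<n}" if "i < r" for i using I that unfolding is_clustering_def by auto
  have disj: "I i \<inter> I k = {}" if "i < r" "k < r" "i \<noteq> k" for i k
    using I that unfolding is_clustering_def disjoint_family_on_def by auto
  define s where "s i = (\<Sum>l\<in>I i. (w $ l)\<^sup>2)" for i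
  have s: "s i > 0" if i: "i < r" for i
  proof -
    obtain j where "j \<in> I i" "w $ j \<noteq> 0" using w[OF i] by auto
    then show ?thesis unfolding s_def
      using finite_subset[OF sub[OF i]] by (intro sum_pos2[of _ j]) auto
  qed
  have "(P * transpose_mat P) $$ (i, k) = (1\<^sub>m r :: real mat) $$ (i, k)" if ik: "i < r" "k < r" for i k
  proof -
    have "(P * transpose_mat P) $$ (i, k) = (\<Sum>j<n. P $$ (i, j) * P $$ (k, j))"
      using Pc ik by (simp add: scalar_prod_def lessThan_atLeast0)
    also have "\<dots> = (\<Sum>j<n. if j \<in> I i then (if i = k then (w $ j)\<^sup>2 / s i else 0) else 0)"
    proof (intro sum.cong refl)
      fix j assume "j \<in> {..<n}"
      then show "P $$ (i, j) * P $$ (k, j) = (if j \<in> I i then (if i = k then (w $ j)\<^sup>2 / s i else 0) else 0)"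
        using ik disj[of i k] s[of i]
        by (auto simp: Pdef clustering_proj_def s_def[symmetric] power2_eq_square[of "w $ j"])
    qed
    also have "\<dots> = (\<Sum>j\<in>I i. if i = k then (w $ j)\<^sup>2 / s i else 0)"
      using sub[OF ik(1)] by (subst sum.inter_restrict[symmetric]) (auto simp: Int_absorb1)
    also have "\<dots> = (if i = k then s i / s i else 0)"
      by (simp add: s_def flip: sum_divide_distrib)
    finally show ?thesis using ik s[of i] by (cases "i = k") auto
  qed
  then show "P * transpose_mat P = 1\<^sub>m r" using Pc by (intro eq_matI) auto
qed

text \<open>With \<open>p = P v\<close> and \<open>q = P^T p\<close>, both
  \<open>q \<bullet> q\<close> and \<open>q \<bullet> v\<close> equal \<open>p \<bullet> p\<close>,
  so \<open>|v - q|^2 = |v|^2 - |p|^2\<close>.\<close>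

lemma complementary_projection_contraction:
  fixes P :: "real mat"
  assumes P: "P \<in> carrier_mat r n" and PP: "P * transpose_mat P = 1\<^sub>m r" and v: "v \<in> carrier_vec n"
  shows "((1\<^sub>m n - transpose_mat P * P) *\<^sub>v v) \<bullet> ((1\<^sub>m n - transpose_mat P * P) *\<^sub>v v) \<le> v \<bullet> v"
proof -
  define p where "p = P *\<^sub>v v"
  define q where "q = transpose_mat P *\<^sub>v p"
  have p: "p \<in> carrier_vec r" and q: "q \<in> carrier_vec n" unfolding p_def q_def using P v by auto
  have "P *\<^sub>v q = p"
    unfolding q_def using assoc_mult_mat_vec[of P r n "transpose_mat P" r p] P PP p by simp
  then have qq: "q \<bullet> q = p \<bullet> p"
    using transpose_vec_mult_scalar[OF P q p] unfolding q_def[symmetric] by simp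
  have qv: "q \<bullet> v = p \<bullet> p"
    using transpose_vec_mult_scalar[OF P v p] unfolding q_def p_def by simp
  have "(1\<^sub>m n - transpose_mat P * P) *\<^sub>v v = v - q"
    unfolding q_def p_def using P v by (subst minus_mult_distrib_mat_vec[of _ n n]) auto
  moreover have "(v - q) \<bullet> (v - q) = v \<bullet> v - q \<bullet> v - (v \<bullet> q - q \<bullet> q)"
    using v q by (simp add: minus_scalar_prod_distrib[of _ n] scalar_prod_minus_distrib[of _ n])
  moreover have "v \<bullet> q = q \<bullet> v" using v q by (rule comm_scalar_prod)
  moreover have "0 \<le> p \<bullet> p" by (simp add: scalar_prod_self sum_nonneg)
  ultimately show ?thesis using qq qv by simp
qed

lemma proj_error_eq:
  assumes "P \<in> carrier_mat r n" and "M \<in> carrier_mat n k"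
  shows "proj_error M P = frob_norm ((1\<^sub>m n - transpose_mat P * P) * M)"
  unfolding proj_error_def using assms
  by (subst minus_mult_distrib_mat[of _ n n]) auto

text \<open>The tail keeps all of \<open>Y\<close> and instead clears the first \<open>k\<close>
  rows of \<open>N\<close>; it can thus be bounded through \<open>sigma_max Y\<close> without
  passing to a submatrix of \<open>Y\<close>.\<close>

lemma mult_truncated:
  fixes N :: "real mat"
  assumes Y: "Y \<in> carrier_mat n l" and N: "N \<in> carrier_mat l c" and k: "k \<le> l"
  shows "Y * N = first_cols k Y * first_rows k N
    + Y * mat l c (\<lambda>(i, j). if i < k then 0 else N $$ (i, j))"
proof (rule eq_matI)
  let ?N2 = "mat l c (\<lambda>(i, j). if i < k then 0 else N $$ (i, j))"
  fix i j assume "i < dim_row (first_cols k Y * first_rows k N + Y * ?N2)"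
    "j < dim_col (first_cols k Y * first_rows k N + Y * ?N2)"
  then have ij: "i < n" "j < c" using Y by auto
  have f: "(first_cols k Y * first_rows k N) $$ (i, j) = (\<Sum>m<k. Y $$ (i, m) * N $$ (m, j))"
    using Y N ij by (simp add: scalar_prod_def lessThan_atLeast0 first_cols_def first_rows_def)
  have g: "(Y * ?N2) $$ (i, j) = (\<Sum>m<l. if m < k then 0 else Y $$ (i, m) * N $$ (m, j))"
    using Y N ij by (auto simp: scalar_prod_def lessThan_atLeast0 intro!: sum.cong)
  have "(Y * N) $$ (i, j) = (\<Sum>m<l. Y $$ (i, m) * N $$ (m, j))"
    using Y N ij by (simp add: scalar_prod_def lessThan_atLeast0)
  also have "\<dots> = (\<Sum>m<l. if m < k then Y $$ (i, m) * N $$ (m, j) else 0)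
      + (\<Sum>m<l. if m < k then 0 else Y $$ (i, m) * N $$ (m, j))"
    unfolding sum.distrib[symmetric] by (intro sum.cong) auto
  also have "(\<Sum>m<l. if m < k then Y $$ (i, m) * N $$ (m, j) else 0) = (\<Sum>m<k. Y $$ (i, m) * N $$ (m, j))"
    using k by (intro sum.mono_neutral_cong_right) auto
  finally show "(Y * N) $$ (i, j) = (first_cols k Y * first_rows k N + Y * ?N2) $$ (i, j)"
    using f g Y N ij by (simp add: first_cols_def first_rows_def)
qed (use Y N in \<open>auto simp: first_cols_def first_rows_def\<close>)

lemma frob_norm_power2_unit_cols:
  assumes "\<forall>j<dim_col B. sqrt (col B j \<bullet> col B j) = 1"
  shows "(frob_norm B)\<^sup>2 = real (dim_col B)"
  unfolding frob_norm_power2_cols using assms by simp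

lemma row_norm_le_frob_norm:
  assumes "i < dim_row M"
  shows "(M * transpose_mat M) $$ (i, i) \<le> (frob_norm M)\<^sup>2"
  unfolding frob_norm_power2_gram using assms
  by (intro member_le_sum[where f = "\<lambda>i. (M * transpose_mat M) $$ (i, i)"])
    (auto simp: scalar_prod_self intro!: sum_nonneg)

text \<open>A minimiser for the truncated factor is a competitor for \<open>M\<close>. Its error on
  \<open>M\<close> exceeds the truncated minimum by at most the norm of the tail.\<close>

lemma min_proj_error_truncation:
  assumes r: "0 < r" "r \<le> n" and M: "M \<in> carrier_mat n n"
    and Y: "Y \<in> carrier_mat n n" and T: "T \<in> carrier_mat n n" and YT: "Y * T = 1\<^sub>m n"
    and k: "k \<le> n" and L: "L \<in> carrier_mat k l"
    and gram: "first_rows k (T * M) * transpose_mat (first_rows k (T * M)) = L * transpose_mat L"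
  shows "min_proj_error n r M - min_proj_error n r (first_cols k Y * L)
    \<le> sigma_max Y * sqrt (\<Sum>i = k..<n. (T * M * transpose_mat (T * M)) $$ (i, i))"
proof -
  let ?N = "T * M" and ?Y1 = "first_cols k Y"
  let ?N1 = "first_rows k ?N"
  define N2 where "N2 = mat n n (\<lambda>(i, j). if i < k then 0 else ?N $$ (i, j))"
  have n: "0 < n" using r by simp
  have N: "?N \<in> carrier_mat n n" and N1: "?N1 \<in> carrier_mat k n" and Y1: "?Y1 \<in> carrier_mat n k"
    and N2: "N2 \<in> carrier_mat n n"
    using T M Y unfolding N2_def by (auto simp: first_rows_def first_cols_def)
  have YL: "?Y1 * L \<in> carrier_mat n l" using Y1 L by simp
  obtain P where P: "P \<in> clustering_projs n r"
    and min: "min_proj_error n r (?Y1 * L) = proj_error (?Y1 * L) P"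
    using min_proj_error_is_minimum(1)[OF r YL] by auto
  note Pc = clustering_proj_gram[OF P]
  let ?C = "1\<^sub>m n - transpose_mat P * P"
  have C: "?C \<in> carrier_mat n n" using Pc(1) by (intro minus_carrier_mat) auto
  have "M = Y * ?N" using assoc_mult_mat[OF Y T M] YT M by simp
  then have split: "M = ?Y1 * ?N1 + Y * N2" unfolding N2_def using mult_truncated[OF Y N k] by simp
  have "proj_error M P = frob_norm (?C * (?Y1 * ?N1 + Y * N2))"
    using proj_error_eq[OF Pc(1) M] split by simp
  also have "?C * (?Y1 * ?N1 + Y * N2) = ?C * (?Y1 * ?N1) + ?C * (Y * N2)"
    using C Y1 N1 Y N2 by (intro mult_add_distrib_mat[of _ n n _ n]) auto
  also have "frob_norm \<dots> \<le> frob_norm (?C * (?Y1 * ?N1)) + frob_norm (?C * (Y * N2))"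
    using C Y1 N1 Y N2 by (intro frob_norm_triangle[of _ n n]) auto
  \<comment> \<open>Both factors have the same Gram matrix, so \<open>L\<close> may replace the
    leading rows although it has \<open>l\<close> columns instead of \<open>n\<close>.\<close>
  also have "frob_norm (?C * (?Y1 * ?N1)) = frob_norm (?C * (?Y1 * L))"
  proof -
    have "frob_norm (?C * ?Y1 * ?N1) = frob_norm (?C * ?Y1 * L)"
      using C Y1 N1 L gram by (intro frob_norm_mult_cong_gram[of _ n k]) auto
    then show ?thesis by (simp only: assoc_mult_mat[OF C Y1 N1] assoc_mult_mat[OF C Y1 L])
  qed
  also have "frob_norm (?C * (?Y1 * L)) = min_proj_error n r (?Y1 * L)"
    unfolding min using proj_error_eq[OF Pc(1) YL] by simp
  also have "frob_norm (?C * (Y * N2)) \<le> 1 * frob_norm (Y * N2)"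
    using Y N2 complementary_projection_contraction[OF Pc] by (intro frob_norm_mult_le[OF C]) auto
  also have "frob_norm (Y * N2) \<le> sigma_max Y * frob_norm N2"
    using mult_mat_vec_le_sigma_max[OF Y n] by (intro frob_norm_mult_le[OF Y N2]) auto
  also have "frob_norm N2 = sqrt (\<Sum>i = k..<n. (?N * transpose_mat ?N) $$ (i, i))"
  proof -
    have "(frob_norm N2)\<^sup>2 = (\<Sum>i<n. if i < k then 0 else (\<Sum>j<n. (?N $$ (i, j))\<^sup>2))"
      unfolding frob_norm_power2 using N2 by (intro sum.cong) (auto simp: N2_def)
    also have "\<dots> = (\<Sum>i = k..<n. \<Sum>j<n. (?N $$ (i, j))\<^sup>2)"
      by (intro sum.mono_neutral_cong_right) auto
    also have "\<dots> = (\<Sum>i = k..<n. (?N * transpose_mat ?N) $$ (i, i))"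
    proof (intro sum.cong refl)
      fix i assume "i \<in> {k..<n}"
      then have "i < dim_row ?N" using N by auto
      then show "(\<Sum>j<n. (?N $$ (i, j))\<^sup>2) = (?N * transpose_mat ?N) $$ (i, i)"
        using N by (simp add: scalar_prod_self del: index_mult_mat(2,3) dim_row_mat)
    qed
    finally show ?thesis using frob_norm_nonneg by (metis real_sqrt_abs abs_of_nonneg)
  qed
  finally have "proj_error M P \<le> min_proj_error n r (?Y1 * L)
      + sigma_max Y * sqrt (\<Sum>i = k..<n. (?N * transpose_mat ?N) $$ (i, i))" by simp
  with min_proj_error_is_minimum(2)[OF r M P] show ?thesis by simp
qed

section \<open>Leading blocks and the final estimate\<close>

lemma first_rows_mult:
  assumes "M \<in> carrier_mat n l" "N \<in> carrier_mat l c" "k \<le> n"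
  shows "first_rows k (M * N) = first_rows k M * N"
  using assms by (intro eq_matI) (auto simp: first_rows_def scalar_prod_def)

lemma first_rows_gram:
  assumes "M \<in> carrier_mat n l" "k \<le> n" "i < k" "j < k"
  shows "(first_rows k M * transpose_mat (first_rows k M)) $$ (i, j) = (M * transpose_mat M) $$ (i, j)"
  using assms by (simp add: first_rows_def scalar_prod_def)

theorem mainTheorem4:
  fixes n m nb r kap :: nat
    and A B Bd Q R G X H Y Z \<Phi> :: "real mat"
    and Qhalf Rinvhalf \<Phi>half \<Omega>1 Mhalf \<Phi>khalf :: "real mat"
    and lam :: "nat \<Rightarrow> real"
    and \<eta> :: real
  assumes "A \<in> carrier_mat n n" and "B \<in> carrier_mat n m" and "Bd \<in> carrier_mat n nb"
    and "Q \<in> carrier_mat n n" and "pos_semidef Q"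
    and "R \<in> carrier_mat m m" and "pos_def R"
    and "G = B * minv R * transpose_mat B"
    and "Qhalf \<in> carrier_mat n n" and "Q = Qhalf * transpose_mat Qhalf"
    and "Rinvhalf \<in> carrier_mat m m" and "minv R = Rinvhalf * transpose_mat Rinvhalf"
    and "observable (transpose_mat Qhalf) A"
    and "stabilizable A (B * Rinvhalf)"
    and "controllable A Bd"
    and "pos_def X" and "stabilizing_riccati_solution A Q G X"
    and "H = hamiltonian A G Q" and "diagonalizable H"
    and "Y \<in> carrier_mat n n" and "Z \<in> carrier_mat n n"
    and "column_span (Y @\<^sub>r Z) = stable_subspace H"
    and "H * (Y @\<^sub>r Z) = (Y @\<^sub>r Z) * mat_diag n lam"
    and "{z \<in> spectrum (cmat H). Re z < 0} = (\<lambda>i. complex_of_real (lam i)) ` {..<n}"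
    and "\<forall>i<n. lam i < 0" and "\<forall>i j. i < j \<longrightarrow> j < n \<longrightarrow> lam j < lam i"
    and "\<Phi> \<in> carrier_mat n n" and "pos_def \<Phi>"
    and "(A - G * X) * \<Phi> + \<Phi> * transpose_mat (A - G * X) + Bd * transpose_mat Bd = 0\<^sub>m n n"
    and "\<Phi>half \<in> carrier_mat n n" and "\<Phi> = \<Phi>half * transpose_mat \<Phi>half"
    and "1 \<le> kap" and "kap < n"
    and "\<Omega>1 = first_rows kap (minv Y)"
    and "Mhalf \<in> carrier_mat kap kap"
    and "Mhalf * transpose_mat Mhalf =
           hadamard (\<Omega>1 * Bd * transpose_mat Bd * transpose_mat \<Omega>1) (cauchy_mat kap lam)"
    and "\<Phi>khalf = first_cols kap Y * Mhalf"
    and "\<eta> = cond_number (minv Y)"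
    and "\<forall>j<nb. sqrt (scalar_prod (col Bd j) (col Bd j)) = 1"
    and "0 < r" and "r \<le> n"
  shows "min_proj_error n r \<Phi>half - min_proj_error n r \<Phi>khalf
           \<le> sqrt (\<eta>\<^sup>2 * real nb * (\<Sum>i = kap..<n. - 1 / (2 * lam i)))"
proof -
  have A: "A \<in> carrier_mat n n" and B: "B \<in> carrier_mat n m" and Bd: "Bd \<in> carrier_mat n nb"
    and Q: "Q \<in> carrier_mat n n" and Y: "Y \<in> carrier_mat n n" and Z: "Z \<in> carrier_mat n n"
    and \<Phi>: "\<Phi> \<in> carrier_mat n n" and \<Phi>half: "\<Phi>half \<in> carrier_mat n n"
    and Mhalf: "Mhalf \<in> carrier_mat kap kap" and kap: "kap \<le> n" and n: "0 < n"
    and r: "0 < r" "r \<le> n"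
    using assms by auto
  have G: "G \<in> carrier_mat n n" using \<open>G = B * minv R * transpose_mat B\<close> B by auto
  have lam: "lam i < 0" if "i < n" for i using that \<open>\<forall>i<n. lam i < 0\<close> by blast
  let ?L = "mat_diag n lam"
  obtain T where T: "T \<in> carrier_mat n n" and YT: "Y * T = 1\<^sub>m n" and TY: "T * Y = 1\<^sub>m n"
    and eig: "(A - G * X) * Y = Y * ?L"
  proof (rule stable_eigenvectors_riccati)
    show "stabilizing_riccati_solution A Q G X" by fact
    show "diagonalizable (hamiltonian A G Q)"
      "column_span (Y @\<^sub>r Z) = stable_subspace (hamiltonian A G Q)"
      "hamiltonian A G Q * (Y @\<^sub>r Z) = (Y @\<^sub>r Z) * ?L"
      using assms by auto
  qed (use A G Q Y Z in auto)
  \<comment> \<open>The second identity is for \<open>\<eta>\<close>: the condition number of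
    \<open>minv Y\<close> becomes \<open>sigma_max T * sigma_max Y\<close>.\<close>
  have minvY: "minv Y = T" and minvT: "minv T = Y"
    using minv_unique[OF Y T YT] minv_unique[OF T Y TY] by auto
  have Xc: "X \<in> carrier_mat n n"
    using \<open>stabilizing_riccati_solution A Q G X\<close> A unfolding stabilizing_riccati_solution_def by simp
  have F: "A - G * X \<in> carrier_mat n n" using A G Xc by auto
  let ?N = "T * \<Phi>half" and ?W = "T * Bd"
  have N: "?N \<in> carrier_mat n n" and W: "?W \<in> carrier_mat n nb" using T \<Phi>half Bd by auto
  have NN: "?N * transpose_mat ?N = T * \<Phi> * transpose_mat T"
    unfolding \<open>\<Phi> = \<Phi>half * transpose_mat \<Phi>half\<close> using T \<Phi>half
    by (simp add: transpose_mult[of _ n n _ n] assoc_mult_mat[of _ n n _ n _ n])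
  \<comment> \<open>All \<open>lam i\<close> are negative, so no denominator vanishes.\<close>
  have entry: "(?N * transpose_mat ?N) $$ (i, j) = - (?W * transpose_mat ?W) $$ (i, j) / (lam i + lam j)"
    if "i < n" "j < n" for i j
    unfolding NN using lam[OF that(1)] lam[OF that(2)]
    by (intro lyapunov_eigencoordinates[OF F \<Phi> Bd _ Y T YT TY eig that] assms) auto
  have \<Omega>1: "\<Omega>1 = first_rows kap T" using \<open>\<Omega>1 = first_rows kap (minv Y)\<close> minvY by simp
  have \<Omega>1c: "\<Omega>1 \<in> carrier_mat kap n" unfolding \<Omega>1 first_rows_def using T by simp
  have \<Omega>1W: "\<Omega>1 * Bd * transpose_mat Bd * transpose_mat \<Omega>1
      = first_rows kap ?W * transpose_mat (first_rows kap ?W)"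
    unfolding first_rows_mult[OF T Bd kap] \<Omega>1[symmetric] using \<Omega>1c Bd
      assoc_mult_mat[of "\<Omega>1 * Bd" kap nb "transpose_mat Bd" n "transpose_mat \<Omega>1" kap]
    by (simp add: transpose_mult[of _ kap n _ nb])
  \<comment> \<open>The leading block of the Gram matrix is the Hadamard product defining
    \<open>Mhalf\<close>, so the two square roots need only agree in this sense.\<close>
  have gram: "first_rows kap ?N * transpose_mat (first_rows kap ?N) = Mhalf * transpose_mat Mhalf"
  proof (rule eq_matI)
    fix i j assume "i < dim_row (Mhalf * transpose_mat Mhalf)" "j < dim_col (Mhalf * transpose_mat Mhalf)"
    then have ij: "i < kap" "j < kap" using Mhalf by auto
    then have "i < n" "j < n" using kap by auto
    have fW: "first_rows kap ?W * transpose_mat (first_rows kap ?W) \<in> carrier_mat kap kap"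
      by (auto simp: first_rows_def)
    have "(Mhalf * transpose_mat Mhalf) $$ (i, j)
        = (?W * transpose_mat ?W) $$ (i, j) * (- 1 / (lam i + lam j))"
      unfolding \<open>Mhalf * transpose_mat Mhalf = _\<close> \<Omega>1W first_rows_gram[OF W kap ij, symmetric]
      using fW ij by (auto simp: hadamard_def cauchy_mat_def)
    then show "(first_rows kap ?N * transpose_mat (first_rows kap ?N)) $$ (i, j)
        = (Mhalf * transpose_mat Mhalf) $$ (i, j)"
      unfolding first_rows_gram[OF N kap ij] entry[OF \<open>i < n\<close> \<open>j < n\<close>] by simp
  qed (use Mhalf in \<open>auto simp: first_rows_def\<close>)
  have sT: "0 \<le> sigma_max T" and sY: "0 \<le> sigma_max Y"
    using sigma_max_nonneg[OF T n] sigma_max_nonneg[OF Y n] by auto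
  have "frob_norm ?W \<le> sigma_max T * frob_norm Bd"
    using mult_mat_vec_le_sigma_max[OF T n] by (intro frob_norm_mult_le[OF T Bd]) auto
  then have "(frob_norm ?W)\<^sup>2 \<le> (sigma_max T * frob_norm Bd)\<^sup>2"
    using frob_norm_nonneg by (intro power_mono) auto
  also have "\<dots> = (sigma_max T)\<^sup>2 * real nb"
    using frob_norm_power2_unit_cols[of Bd] Bd
      \<open>\<forall>j<nb. sqrt (col Bd j \<bullet> col Bd j) = 1\<close> by (simp add: power_mult_distrib)
  finally have frobW: "(frob_norm ?W)\<^sup>2 \<le> (sigma_max T)\<^sup>2 * real nb" .
  \<comment> \<open>The indices from \<open>kap\<close> to \<open>n - 1\<close> are the discarded
    eigenvalues when counting from 0. Each squared row norm of \<open>T * Bd\<close> is bounded by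
    the whole squared Frobenius norm, at most \<open>(sigma_max T)^2 * nb\<close>.\<close>
  have "(\<Sum>i = kap..<n. (?N * transpose_mat ?N) $$ (i, i))
      \<le> (\<Sum>i = kap..<n. (sigma_max T)\<^sup>2 * real nb * (- 1 / (2 * lam i)))"
  proof (rule sum_mono)
    fix i assume "i \<in> {kap..<n}"
    then have i: "i < n" by simp
    have "(?W * transpose_mat ?W) $$ (i, i) \<le> (sigma_max T)\<^sup>2 * real nb"
      using row_norm_le_frob_norm[of i ?W] frobW W i by auto
    moreover have "0 \<le> - 1 / (2 * lam i)" using lam[OF i] by (simp add: divide_nonpos_neg)
    ultimately have "(?W * transpose_mat ?W) $$ (i, i) * (- 1 / (2 * lam i))
        \<le> (sigma_max T)\<^sup>2 * real nb * (- 1 / (2 * lam i))" by (rule mult_right_mono)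
    then show "(?N * transpose_mat ?N) $$ (i, i) \<le> (sigma_max T)\<^sup>2 * real nb * (- 1 / (2 * lam i))"
      unfolding entry[OF i i] by simp
  qed
  then have tail: "(\<Sum>i = kap..<n. (?N * transpose_mat ?N) $$ (i, i))
      \<le> (sigma_max T)\<^sup>2 * real nb * (\<Sum>i = kap..<n. - 1 / (2 * lam i))"
    by (simp only: sum_distrib_left)
  have "min_proj_error n r \<Phi>half - min_proj_error n r \<Phi>khalf
      \<le> sigma_max Y * sqrt (\<Sum>i = kap..<n. (?N * transpose_mat ?N) $$ (i, i))"
    unfolding \<open>\<Phi>khalf = first_cols kap Y * Mhalf\<close>
    by (rule min_proj_error_truncation[OF r \<Phi>half Y T YT kap Mhalf gram])
  also have "\<dots> \<le> sigma_max Y * sqrt ((sigma_max T)\<^sup>2 * real nb * (\<Sum>i = kap..<n. - 1 / (2 * lam i)))"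
    using tail sY by (intro mult_left_mono real_sqrt_le_mono) auto
  also have "\<dots> = sqrt ((sigma_max Y)\<^sup>2 * ((sigma_max T)\<^sup>2 * real nb * (\<Sum>i = kap..<n. - 1 / (2 * lam i))))"
    using sY by (simp add: real_sqrt_mult)
  also have "(sigma_max Y)\<^sup>2 * ((sigma_max T)\<^sup>2 * real nb * (\<Sum>i = kap..<n. - 1 / (2 * lam i)))
      = \<eta>\<^sup>2 * real nb * (\<Sum>i = kap..<n. - 1 / (2 * lam i))"
    unfolding \<open>\<eta> = cond_number (minv Y)\<close> cond_number_def minvY minvT
    by (simp add: power_mult_distrib algebra_simps)
  finally show ?thesis .
qed

end
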